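(* Let $f\in\mathcal{N}_K$ be the target density function, let $\lambda>0$, and let $f^{\lambda}_{M,N;\boldsymbol{Y}}\in V_N$ satisfy $$\langle f^{\lambda}_{M,N;\boldsymbol{Y}},v\rangle_{\lambda}=\frac1M\sum_{m=1}^M v(Y_m)\quad\text{for all }v\in V_N .$$ Let $\mathscr{P}_N\colon\mathcal{N}_K\to V_N$ be the $\mathcal{N}_K$-orthogonal projection. Suppose that for some $\tau\in(0,1]$ we have $\Delta_{\boldsymbol{Y}}\in\mathcal{N}_K^{-\tau}$, and that $\langle K_\tau(\cdot,\cdot),f\rangle_{L^2_\mu(D)}:=\int_D K_\tau(x,x)f(x)\,\mathrm{d}\mu(x)<\infty$, where $K_\tau(x_1,x_2)=\sum_{\ell=0}^\infty\beta_\ell^\tau\varphi_\ell(x_1)\varphi_\ell(x_2)$. Then $$\mathbb{E}\Bigl[\int_D|f^{\lambda}_{M,N;\boldsymbol{Y}}(x)-f(x)|^2\,\mathrm{d}\mu(x)\Bigr]\le\|\mathscr{P}_Nf-f\|^2_{L^2_\mu(D)}+\lambda\|f\|_K^2+\frac{\langle K_\tau(\cdot,\cdot),f\rangle_{L^2_\mu(D)}}{M\lambda^\tau}.$$ Suppose furthermore that $f\in\mathcal{N}_K^2$. Then also $$\mathbb{E}\Bigl[\int_D|f^{\lambda}_{M,N;\boldsymbol{Y}}(x)-f(x)|^2\,\mathrm{d}\mu(x)\Bigr]\le3\|\mathscr{P}_Nf-f\|^2_{L^2_\mu(D)}+8\lambda^2\|f\|_{\mathcal{N}_K^2}^2+\frac{\langle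 K_\tau(\cdot,\cdot),f\rangle_{L^2_\mu(D)}}{M\lambda^\tau}.$$
   Context: $(D,\mathcal{B},\mu)$ is a measure space and $K\colon D\times D\to\mathbb{R}$ is a positive definite kernel (symmetric, with $\sum_{j,k}t_jK(x_j,x_k)t_k\ge0$ for all finite families $t_j\in\mathbb{R}$, $x_j\in D$). $(\mathcal{N}_K,\langle\cdot,\cdot\rangle_K,\|\cdot\|_K)$ is its reproducing kernel Hilbert space. It is assumed that $\int_D\sqrt{K(x,x)}\,\mathrm{d}\mu(x)<\infty$, $\int_DK(x,x)\,\mathrm{d}\mu(x)<\infty$, and that $K(x,x')=\sum_{\ell=0}^\infty\beta_\ell\varphi_\ell(x)\varphi_\ell(x')$ for all $x,x'\in D$ with pointwise absolutely convergent series, where $\beta_\ell>0$, $\beta_\ell\to0$, $\{\sqrt{\beta_\ell}\varphi_\ell\}_{\ell\ge0}$ is a complete orthonormal system of $\mathcal{N}_K$, and $\{\varphi_\ell\}_{\ell\ge0}$ is an orthonormal system of $L^2_\mu(D)$. Thus $\langle u,w\rangle_K=\sum_\ell\beta_\ell^{-1}\langle u,\varphi_\ell\rangle_{L^2_\mu(D)}\langle w,\varphi_\ell\rangle_{L^2_\mu(D)}$. $Y_1,\dots,Y_M\colon\Omega\to D$ ($M\ge1$) are independent random variables on a probability space $(\Omega,\mathcal{F},\mathbb{P})$, each with distribution $A\mapsto\int_Af\,\mathrm{d}\mu$, $A\in\mathcal{B}$; $\boldsymbol{Y}=(Y_1,\dots,Y_M)$. For $\lambda>0$ and $u,w\in\mathcal{N}_K$,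 $\langle u,w\rangle_\lambda:=\langle u,w\rangle_{L^2_\mu(D)}+\lambda\langle u,w\rangle_K$. Given an arbitrary point set $\{x_1,\dots,x_N\}\subset D$, $V_N:=\mathrm{span}\{K(x_j,\cdot)\mid j=1,\dots,N\}$. The variational problem in the claim has a unique solution in $V_N$ for each $\omega\in\Omega$. For $\tau>0$, $\mathcal{N}_K^\tau$ is the space of $v\in L^2_\mu(D)$ with $v=\sum_\ell\langle v,\varphi_\ell\rangle_{L^2_\mu(D)}\varphi_\ell$ and $\|v\|_{\mathcal{N}_K^\tau}:=\bigl(\sum_{\ell}\beta_\ell^{-\tau}|\langle v,\varphi_\ell\rangle_{L^2_\mu(D)}|^2\bigr)^{1/2}<\infty$; $\mathcal{N}_K^1=\mathcal{N}_K$. $\mathcal{N}_K^{-\tau}$ is the space of functionals $\Psi(v)=\sum_\ell\Psi_\ell\langle\varphi_\ell,v\rangle_{L^2_\mu(D)}$ on $\mathcal{N}_K^\tau$ with real coefficients satisfying $\|\Psi\|_{\mathcal{N}_K^{-\tau}}:=\bigl(\sum_\ell\beta_\ell^\tau\Psi_\ell^2\bigr)^{1/2}<\infty$. $\Delta_{\boldsymbol{Y}}$ is the (random) functional $\Delta_{\boldsymbol{Y}}(v):=\frac1M\sum_{m=1}^Mv(Y_m)$. The condition $\Delta_{\boldsymbol{Y}}\in\mathcal{N}_K^{-\tau}$ refers to the functional with coefficients $\Delta_{\boldsymbol{Y}}(\varphi_\ell)$. *)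

theory Defs
  imports "HOL-Probability.Probability"
begin

text \<open>
  Convention: a function on a set \<open>D\<close> (here \<open>D = space \<mu>\<close>) is represented by any total function on
  the ambient type with the right values on \<open>D\<close>.  Sets of functions are closed under changing
  values outside \<open>D\<close>, and two representatives denote the same function iff they agree on \<open>D\<close>.
\<close>

definition pos_def_kernel :: "'a set \<Rightarrow> ('a \<Rightarrow> 'a \<Rightarrow> real) \<Rightarrow> bool" where
  "pos_def_kernel D K \<longleftrightarrow>
     (\<forall>x\<in>D. \<forall>y\<in>D. K x y = K y x) \<and>
     (\<forall>(n::nat) (t :: nat \<Rightarrow> real) (x :: nat \<Rightarrow> 'a). (\<forall>j<n. x j \<in> D) \<longrightarrow>
        0 \<le> (\<Sum>j<n. \<Sum>k<n. t j * K (x j) (x k) * t k))"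

text \<open>
  \<open>H\<close> with inner product \<open>ip\<close> is the reproducing kernel Hilbert space of \<open>K\<close> on \<open>D\<close>.  By the
  Moore--Aronszajn theorem it exists and is determined by \<open>D\<close> and \<open>K\<close> (\<open>ip\<close> is
  unconstrained off \<open>H\<close>).
\<close>

locale rkhs =
  fixes D :: "'a set"
    and K :: "'a \<Rightarrow> 'a \<Rightarrow> real"
    and H :: "('a \<Rightarrow> real) set"
    and ip :: "('a \<Rightarrow> real) \<Rightarrow> ('a \<Rightarrow> real) \<Rightarrow> real"
  assumes pos_def: "pos_def_kernel D K"
    and H_cong: "u \<in> H \<Longrightarrow> (\<And>x. x \<in> D \<Longrightarrow> v x = u x) \<Longrightarrow> v \<in> H"
    and H_zero: "(\<lambda>x. 0) \<in> H"
    and H_add: "u \<in> H \<Longrightarrow> v \<in> H \<Longrightarrow> (\<lambda>x. u x + v x) \<in> H"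
    and H_scale: "u \<in> H \<Longrightarrow> (\<lambda>x. c * u x) \<in> H"
    and ip_sym: "u \<in> H \<Longrightarrow> v \<in> H \<Longrightarrow> ip u v = ip v u"
    and ip_add: "u \<in> H \<Longrightarrow> v \<in> H \<Longrightarrow> w \<in> H \<Longrightarrow> ip (\<lambda>x. u x + v x) w = ip u w + ip v w"
    and ip_scale: "u \<in> H \<Longrightarrow> w \<in> H \<Longrightarrow> ip (\<lambda>x. c * u x) w = c * ip u w"
    and ip_nonneg: "u \<in> H \<Longrightarrow> 0 \<le> ip u u"
    and ip_eq_0: "u \<in> H \<Longrightarrow> ip u u = 0 \<longleftrightarrow> (\<forall>x\<in>D. u x = 0)"
    and complete:
      "(\<And>n. X n \<in> H) \<Longrightarrow>
       (\<And>e. 0 < e \<Longrightarrow> \<exists>n0. \<forall>m\<ge>n0. \<forall>n\<ge>n0. sqrt (ip (\<lambda>x. X m x - X n x) (\<lambda>x. X m x - X n x)) < e) \<Longrightarrow>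
       \<exists>u\<in>H. (\<lambda>n. sqrt (ip (\<lambda>x. X n x - u x) (\<lambda>x. X n x - u x))) \<longlonglongrightarrow> 0"
    and section_in_H: "x \<in> D \<Longrightarrow> K x \<in> H"
    and reproducing: "u \<in> H \<Longrightarrow> x \<in> D \<Longrightarrow> ip u (K x) = u x"

definition l2_space :: "'a measure \<Rightarrow> ('a \<Rightarrow> real) set" where
  "l2_space \<mu> = {u. u \<in> borel_measurable \<mu> \<and> integrable \<mu> (\<lambda>x. (u x)\<^sup>2)}"

definition l2_inner :: "'a measure \<Rightarrow> ('a \<Rightarrow> real) \<Rightarrow> ('a \<Rightarrow> real) \<Rightarrow> real" where
  "l2_inner \<mu> u v = (LINT x|\<mu>. u x * v x)"

locale mercer_rkhs = rkhs "space \<mu>" K H ip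
  for \<mu> :: "'a measure"
    and K :: "'a \<Rightarrow> 'a \<Rightarrow> real"
    and H :: "('a \<Rightarrow> real) set"
    and ip :: "('a \<Rightarrow> real) \<Rightarrow> ('a \<Rightarrow> real) \<Rightarrow> real" +
  fixes \<beta> :: "nat \<Rightarrow> real"
    and \<phi> :: "nat \<Rightarrow> 'a \<Rightarrow> real"
  assumes integrable_sqrt_diag: "integrable \<mu> (\<lambda>x. sqrt (K x x))"
    and integrable_diag: "integrable \<mu> (\<lambda>x. K x x)"
    and beta_pos: "0 < \<beta> l"
    and beta_tendsto_0: "\<beta> \<longlonglongrightarrow> 0"
    and kernel_abs_summable:
      "x \<in> space \<mu> \<Longrightarrow> y \<in> space \<mu> \<Longrightarrow> summable (\<lambda>l. \<bar>\<beta> l * \<phi> l x * \<phi> l y\<bar>)"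
    and kernel_expansion:
      "x \<in> space \<mu> \<Longrightarrow> y \<in> space \<mu> \<Longrightarrow> K x y = (\<Sum>l. \<beta> l * \<phi> l x * \<phi> l y)"
    and onb_in_H: "(\<lambda>x. sqrt (\<beta> l) * \<phi> l x) \<in> H"
    and onb_orthonormal:
      "ip (\<lambda>x. sqrt (\<beta> k) * \<phi> k x) (\<lambda>x. sqrt (\<beta> l) * \<phi> l x) = (if k = l then 1 else 0)"
    and onb_complete:
      "u \<in> H \<Longrightarrow> (\<And>l. ip u (\<lambda>x. sqrt (\<beta> l) * \<phi> l x) = 0) \<Longrightarrow> \<forall>x\<in>space \<mu>. u x = 0"
    and phi_in_l2: "\<phi> l \<in> l2_space \<mu>"
    and phi_orthonormal: "l2_inner \<mu> (\<phi> k) (\<phi> l) = (if k = l then 1 else 0)"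

definition lambda_inner ::
  "'a measure \<Rightarrow> (('a \<Rightarrow> real) \<Rightarrow> ('a \<Rightarrow> real) \<Rightarrow> real) \<Rightarrow> real \<Rightarrow> ('a \<Rightarrow> real) \<Rightarrow> ('a \<Rightarrow> real) \<Rightarrow> real" where
  "lambda_inner \<mu> ip lam u w = l2_inner \<mu> u w + lam * ip u w"

definition kernel_span :: "'a set \<Rightarrow> ('a \<Rightarrow> 'a \<Rightarrow> real) \<Rightarrow> (nat \<Rightarrow> 'a) \<Rightarrow> nat \<Rightarrow> ('a \<Rightarrow> real) set" where
  "kernel_span D K x N = {v. \<exists>c :: nat \<Rightarrow> real. \<forall>y\<in>D. v y = (\<Sum>j=1..N. c j * K (x j) y)}"

definition orthogonal_projection ::
  "(('a \<Rightarrow> real) \<Rightarrow> ('a \<Rightarrow> real) \<Rightarrow> real) \<Rightarrow> ('a \<Rightarrow> real) set \<Rightarrow> ('a \<Rightarrow> real) set \<Rightarrow>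
   (('a \<Rightarrow> real) \<Rightarrow> ('a \<Rightarrow> real)) \<Rightarrow> bool" where
  "orthogonal_projection ip H V Q \<longleftrightarrow>
     (\<forall>u\<in>H. Q u \<in> V \<and> (\<forall>v\<in>V. ip (\<lambda>x. u x - Q u x) v = 0))"

text \<open>The scale of spaces \<open>N\<^sub>K\<^sup>\<tau>\<close>; the expansion of \<open>v\<close> in the \<open>\<phi> l\<close> is understood in \<open>L\<^sup>2\<close>.\<close>

definition power_space :: "'a measure \<Rightarrow> (nat \<Rightarrow> real) \<Rightarrow> (nat \<Rightarrow> 'a \<Rightarrow> real) \<Rightarrow> real \<Rightarrow> ('a \<Rightarrow> real) set" where
  "power_space \<mu> \<beta> \<phi> \<tau> = {v \<in> l2_space \<mu>.
     (\<lambda>n. LINT x|\<mu>. (v x - (\<Sum>l<n. l2_inner \<mu> v (\<phi> l) * \<phi> l x))\<^sup>2) \<longlonglongrightarrow> 0 \<and>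
     summable (\<lambda>l. \<beta> l powr (-\<tau>) * (l2_inner \<mu> v (\<phi> l))\<^sup>2)}"

definition power_norm :: "'a measure \<Rightarrow> (nat \<Rightarrow> real) \<Rightarrow> (nat \<Rightarrow> 'a \<Rightarrow> real) \<Rightarrow> real \<Rightarrow> ('a \<Rightarrow> real) \<Rightarrow> real" where
  "power_norm \<mu> \<beta> \<phi> \<tau> v = sqrt (\<Sum>l. \<beta> l powr (-\<tau>) * (l2_inner \<mu> v (\<phi> l))\<^sup>2)"

definition coeff_functional ::
  "'a measure \<Rightarrow> (nat \<Rightarrow> 'a \<Rightarrow> real) \<Rightarrow> (nat \<Rightarrow> real) \<Rightarrow> ('a \<Rightarrow> real) \<Rightarrow> real" where
  "coeff_functional \<mu> \<phi> c v = (\<Sum>l. c l * l2_inner \<mu> (\<phi> l) v)"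

text \<open>
  The space \<open>N\<^sub>K\<^sup>-\<^sup>\<tau>\<close>; functionals are compared only on \<open>N\<^sub>K\<^sup>\<tau>\<close>.  The coefficients \<open>c\<close> of a member are
  unique, since \<open>\<phi> l\<close> belongs to \<open>N\<^sub>K\<^sup>\<tau>\<close> and is mapped to \<open>c l\<close>.
\<close>

definition neg_power_space ::
  "'a measure \<Rightarrow> (nat \<Rightarrow> real) \<Rightarrow> (nat \<Rightarrow> 'a \<Rightarrow> real) \<Rightarrow> real \<Rightarrow> (('a \<Rightarrow> real) \<Rightarrow> real) set" where
  "neg_power_space \<mu> \<beta> \<phi> \<tau> = {\<Psi>. \<exists>c. summable (\<lambda>l. \<beta> l powr \<tau> * (c l)\<^sup>2) \<and>
     (\<forall>v\<in>power_space \<mu> \<beta> \<phi> \<tau>. \<Psi> v = coeff_functional \<mu> \<phi> c v)}"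

definition sample_mean :: "nat \<Rightarrow> (nat \<Rightarrow> 'a) \<Rightarrow> ('a \<Rightarrow> real) \<Rightarrow> real" where
  "sample_mean M y v = (1 / real M) * (\<Sum>m=1..M. v (y m))"

text \<open>
  \<open>K\<^sub>\<tau>\<close> takes values in \<open>ereal\<close>: on the diagonal all terms are nonnegative, so the series always
  has a value in \<open>[0, \<infinity>]\<close>, and \<open>K\<^sub>\<tau>(x, x) = \<infinity>\<close> is not excluded a priori.
\<close>

definition K_tau :: "(nat \<Rightarrow> real) \<Rightarrow> (nat \<Rightarrow> 'a \<Rightarrow> real) \<Rightarrow> real \<Rightarrow> 'a \<Rightarrow> 'a \<Rightarrow> ereal" where
  "K_tau \<beta> \<phi> \<tau> x1 x2 = (\<Sum>l. ereal (\<beta> l powr \<tau> * \<phi> l x1 * \<phi> l x2))"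

text \<open>For \<open>f \<ge> 0\<close> almost everywhere; where \<open>f x = 0\<close> the integrand is 0 even if \<open>K\<^sub>\<tau>(x, x) = \<infinity>\<close>.\<close>

definition K_tau_pairing ::
  "'a measure \<Rightarrow> (nat \<Rightarrow> real) \<Rightarrow> (nat \<Rightarrow> 'a \<Rightarrow> real) \<Rightarrow> real \<Rightarrow> ('a \<Rightarrow> real) \<Rightarrow> ennreal" where
  "K_tau_pairing \<mu> \<beta> \<phi> \<tau> f = (\<integral>\<^sup>+x. e2ennreal (K_tau \<beta> \<phi> \<tau> x x * ereal (f x)) \<partial>\<mu>)"

end

theory Submission
  imports Defs
begin

text \<open>
  Let \<open>u \<in> V\<close> be the Galerkin solution in which the sample mean is replaced by its expectation
  \<open>v \<mapsto> \<langle>f, v\<rangle>\<close>.  Since the estimator \<open>F \<omega>\<close> depends linearly on the sample mean, \<open>u\<close> is its mean, and the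
  expected squared error is the bias \<open>\<parallel>u - f\<parallel>\<^sup>2\<close> plus the variance \<open>E \<parallel>F - u\<parallel>\<^sup>2\<close>, all in \<open>L\<^sup>2\<close>.

  Bias.  The function \<open>u\<close> minimises \<open>\<parallel>v - f\<parallel>\<^sup>2 + \<lambda> \<parallel>v\<parallel>\<^sub>K\<^sup>2\<close> over \<open>V\<close>, and the comparison with the
  projection of \<open>f\<close>, whose Hilbert norm is at most that of \<open>f\<close>, gives the first bound
  (\<open>bias_bound\<close>).  If \<open>f\<close> has order 2, then \<open>|\<langle>f, v\<rangle>\<^sub>K|\<close> is bounded by the \<open>L\<^sup>2\<close> norm of \<open>v\<close> times the
  norm of order 2 of \<open>f\<close> (\<open>ip_le_power_norm\<close>), and the Galerkin equation tested with the difference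
  between \<open>u\<close> and the projection gives a quadratic inequality for \<open>\<parallel>u - f\<parallel>\<close> (\<open>bias_bound_smooth\<close>).

  Variance.  The difference \<open>d = F \<omega> - u\<close> satisfies \<open>\<langle>d, v\<rangle>\<^sub>\<lambda> = \<Lambda> v\<close> for \<open>v \<in> V\<close>, where \<open>\<Lambda>\<close> is the deviation
  of the sample mean from its expectation.  Expanding \<open>d\<close> in the \<open>\<phi> l\<close>, Cauchy--Schwarz with weights
  \<open>\<beta>\<^sup>\<tau>\<close> and the interpolation \<open>\<lambda>\<^sup>\<tau> \<Sum> \<beta>\<^sup>-\<^sup>\<tau> d\<^sub>l\<^sup>2 \<le> \<langle>d, d\<rangle>\<^sub>\<lambda>\<close> bound \<open>\<langle>d, d\<rangle>\<^sub>\<lambda>\<close> by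
  \<open>\<lambda>\<^sup>-\<^sup>\<tau> \<Sum> \<beta>\<^sup>\<tau> \<Lambda>(\<phi> l)\<^sup>2\<close> (\<open>variational_dual_bound\<close>).  By independence the mean of \<open>\<Lambda>(\<phi> l)\<^sup>2\<close> is at most
  \<open>\<integral> \<phi> l\<^sup>2 f / M\<close>, and the weighted sum of these integrals is the pairing of \<open>K\<^sub>\<tau>\<close> with \<open>f\<close>
  (\<open>sampling_error_bound\<close>).

  The expansions rest on one estimate: \<open>|v(x)|\<^sup>2 \<le> \<parallel>v\<parallel>\<^sub>K\<^sup>2 K(x,x)\<close> with an integrable right-hand side
  makes Fourier series converge simultaneously in the Hilbert space, pointwise and in \<open>L\<^sup>2\<close>.
\<close>

section \<open>Semi-inner products on spaces of functions\<close>

text \<open>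
  Three bilinear forms live on the Hilbert space \<open>H\<close>: its own inner product, the \<open>L\<^sup>2\<close> inner
  product, and the combination \<open>\<langle>\<cdot>,\<cdot>\<rangle>\<^sub>\<lambda>\<close>.  The locale provides their common algebra.  Definiteness
  is left out because \<open>L\<^sup>2\<close> does not separate functions that differ on a null set.
\<close>

locale semi_inner_functions =
  fixes H :: "('a \<Rightarrow> real) set"
    and B :: "('a \<Rightarrow> real) \<Rightarrow> ('a \<Rightarrow> real) \<Rightarrow> real"
  assumes zero_mem: "(\<lambda>x. 0) \<in> H"
    and add_mem: "u \<in> H \<Longrightarrow> v \<in> H \<Longrightarrow> (\<lambda>x. u x + v x) \<in> H"
    and scale_mem: "u \<in> H \<Longrightarrow> (\<lambda>x. c * u x) \<in> H"
    and sym: "u \<in> H \<Longrightarrow> v \<in> H \<Longrightarrow> B u v = B v u"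
    and add_left: "u \<in> H \<Longrightarrow> v \<in> H \<Longrightarrow> w \<in> H \<Longrightarrow> B (\<lambda>x. u x + v x) w = B u w + B v w"
    and scale_left: "u \<in> H \<Longrightarrow> w \<in> H \<Longrightarrow> B (\<lambda>x. c * u x) w = c * B u w"
    and nonneg: "u \<in> H \<Longrightarrow> 0 \<le> B u u"
begin

lemma diff_mem:
  assumes "u \<in> H" "v \<in> H"
  shows "(\<lambda>x. u x - v x) \<in> H"
  using add_mem[OF assms(1) scale_mem[OF assms(2), of "-1"]] by simp

lemma sum_mem:
  assumes "\<And>i. i \<in> I \<Longrightarrow> g i \<in> H"
  shows "(\<lambda>x. \<Sum>i\<in>I. c i * g i x) \<in> H"
  using assms
proof (induction I rule: infinite_finite_induct)
  case (insert i I)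
  then show ?case
    using add_mem[OF scale_mem[of "g i" "c i"] insert.IH] by simp
qed (simp_all add: zero_mem)

lemma diff_left:
  assumes "u \<in> H" "v \<in> H" "w \<in> H"
  shows "B (\<lambda>x. u x - v x) w = B u w - B v w"
  using add_left[OF assms(1) scale_mem[OF assms(2), of "-1"] assms(3)]
    scale_left[OF assms(2,3), of "-1"] by simp

lemma sum_left:
  assumes "\<And>i. i \<in> I \<Longrightarrow> g i \<in> H" "w \<in> H"
  shows "B (\<lambda>x. \<Sum>i\<in>I. c i * g i x) w = (\<Sum>i\<in>I. c i * B (g i) w)"
  using assms
proof (induction I rule: infinite_finite_induct)
  case (insert i I)
  then have "B (\<lambda>x. c i * g i x + (\<Sum>i\<in>I. c i * g i x)) w
      = c i * B (g i) w + B (\<lambda>x. \<Sum>i\<in>I. c i * g i x) w"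
    by (subst add_left) (auto intro!: scale_mem sum_mem simp: scale_left)
  with insert show ?case by simp
qed (use scale_left[OF zero_mem, of _ 0] in simp_all)

lemma add_right:
  assumes "u \<in> H" "v \<in> H" "w \<in> H"
  shows "B w (\<lambda>x. u x + v x) = B w u + B w v"
  using assms by (simp add: sym[of w] add_mem add_left)

lemma diff_right:
  assumes "u \<in> H" "v \<in> H" "w \<in> H"
  shows "B w (\<lambda>x. u x - v x) = B w u - B w v"
  using assms by (simp add: sym[of w] diff_mem diff_left)

lemma scale_right:
  assumes "u \<in> H" "w \<in> H"
  shows "B w (\<lambda>x. c * u x) = c * B w u"
  using assms by (simp add: sym[of w] scale_mem scale_left)

lemma sum_right:
  assumes "\<And>i. i \<in> I \<Longrightarrow> g i \<in> H" "w \<in> H"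
  shows "B w (\<lambda>x. \<Sum>i\<in>I. c i * g i x) = (\<Sum>i\<in>I. c i * B w (g i))"
  using assms by (simp add: sym[of w] sum_mem sum_left)

lemma cauchy_schwarz:
  assumes u: "u \<in> H" and v: "v \<in> H"
  shows "(B u v)\<^sup>2 \<le> B u u * B v v"
proof -
  have q: "0 \<le> B u u - 2 * t * B u v + t\<^sup>2 * B v v" for t
  proof -
    have "0 \<le> B (\<lambda>x. u x - t * v x) (\<lambda>x. u x - t * v x)"
      by (intro nonneg diff_mem scale_mem u v)
    also have "\<dots> = B u u - 2 * t * B u v + t\<^sup>2 * B v v"
      using u v sym[OF u v]
      by (simp add: diff_left diff_right diff_mem scale_mem scale_left scale_right
          power2_eq_square algebra_simps)
    finally show ?thesis .
  qed
  show ?thesis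
  proof (cases "B v v = 0")
    case True
    have "B u v = 0"
    proof (rule ccontr)
      assume "B u v \<noteq> 0"
      then show False
        using q[of "(B u u + 1) / (2 * B u v)"] True by simp
    qed
    then show ?thesis using True by simp
  next
    case False
    then have "0 < B v v" using nonneg[OF v] by simp
    then show ?thesis
      using q[of "B u v / B v v"] by (simp add: field_simps power2_eq_square)
  qed
qed

text \<open>
  Members of \<open>H\<close> are total functions of which only the values on \<open>D\<close> matter.  If a form vanishes
  on the functions that are zero on \<open>D\<close>, Cauchy--Schwarz makes it blind to the values outside \<open>D\<close>.
\<close>

lemma cong:
  assumes definite: "\<And>w. w \<in> H \<Longrightarrow> (\<And>y. y \<in> D \<Longrightarrow> w y = 0) \<Longrightarrow> B w w = 0"
    and H: "u \<in> H" "v \<in> H" "w \<in> H" and eq: "\<And>y. y \<in> D \<Longrightarrow> u y = v y"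
  shows "B u w = B v w"
proof -
  have "B (\<lambda>x. u x - v x) (\<lambda>x. u x - v x) = 0"
    using H eq by (intro definite diff_mem) auto
  then have "(B (\<lambda>x. u x - v x) w)\<^sup>2 \<le> 0"
    using cauchy_schwarz[OF diff_mem[OF H(1,2)] H(3)] by simp
  then show ?thesis using H by (simp add: diff_left)
qed

lemma norm_orthonormal_sum:
  assumes "finite I" "\<And>i. i \<in> I \<Longrightarrow> g i \<in> H"
    and "\<And>i j. i \<in> I \<Longrightarrow> j \<in> I \<Longrightarrow> B (g i) (g j) = (if i = j then 1 else 0)"
  shows "B (\<lambda>x. \<Sum>i\<in>I. c i * g i x) (\<lambda>x. \<Sum>i\<in>I. c i * g i x) = (\<Sum>i\<in>I. (c i)\<^sup>2)"
proof -
  have "B (\<lambda>x. \<Sum>i\<in>I. c i * g i x) (\<lambda>x. \<Sum>i\<in>I. c i * g i x)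
      = (\<Sum>i\<in>I. c i * (\<Sum>j\<in>I. c j * B (g i) (g j)))"
    using assms by (simp add: sum_left sum_right sum_mem)
  also have "\<dots> = (\<Sum>i\<in>I. c i * (\<Sum>j\<in>I. if i = j then c j else 0))"
    using assms by (intro sum.cong refl arg_cong2[where f = "(*)"]) auto
  also have "\<dots> = (\<Sum>i\<in>I. (c i)\<^sup>2)"
    using assms(1) by (simp add: power2_eq_square)
  finally show ?thesis .
qed

lemma bessel_identity:
  assumes "finite I" "\<And>i. i \<in> I \<Longrightarrow> g i \<in> H" "u \<in> H"
    and "\<And>i j. i \<in> I \<Longrightarrow> j \<in> I \<Longrightarrow> B (g i) (g j) = (if i = j then 1 else 0)"
  shows "B (\<lambda>x. u x - (\<Sum>i\<in>I. B u (g i) * g i x)) (\<lambda>x. u x - (\<Sum>i\<in>I. B u (g i) * g i x))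
    = B u u - (\<Sum>i\<in>I. (B u (g i))\<^sup>2)"
proof -
  let ?S = "\<lambda>x. \<Sum>i\<in>I. B u (g i) * g i x"
  have S: "?S \<in> H" using assms by (intro sum_mem) auto
  have uS: "B u ?S = (\<Sum>i\<in>I. (B u (g i))\<^sup>2)"
    using assms by (simp add: sum_right power2_eq_square)
  have "B (\<lambda>x. u x - ?S x) (\<lambda>x. u x - ?S x) = B u u - B u ?S - (B ?S u - B ?S ?S)"
    using S assms(3) by (simp add: diff_left diff_right diff_mem)
  also have "B ?S u = B u ?S" using S assms(3) by (rule sym)
  also have "B ?S ?S = (\<Sum>i\<in>I. (B u (g i))\<^sup>2)"
    using assms by (intro norm_orthonormal_sum) auto
  finally show ?thesis using uS by simp
qed

end

section \<open>Spans of kernel sections\<close>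

lemma kernel_span_mem_iff:
  "v \<in> kernel_span D K x N \<longleftrightarrow> (\<exists>c. \<forall>y\<in>D. v y = (\<Sum>j=1..N. c j * K (x j) y))"
  by (simp add: kernel_span_def)

lemma kernel_span_add:
  assumes "u \<in> kernel_span D K x N" "v \<in> kernel_span D K x N"
  shows "(\<lambda>y. u y + v y) \<in> kernel_span D K x N"
proof -
  obtain a b where "\<forall>y\<in>D. u y = (\<Sum>j=1..N. a j * K (x j) y)"
    "\<forall>y\<in>D. v y = (\<Sum>j=1..N. b j * K (x j) y)"
    using assms by (auto simp: kernel_span_def)
  then have "\<forall>y\<in>D. u y + v y = (\<Sum>j=1..N. (a j + b j) * K (x j) y)"
    by (simp add: ring_distribs sum.distrib)
  then show ?thesis
    unfolding kernel_span_mem_iff by (rule exI[where x = "\<lambda>j. a j + b j"])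
qed

lemma kernel_span_scale:
  assumes "u \<in> kernel_span D K x N"
  shows "(\<lambda>y. c * u y) \<in> kernel_span D K x N"
proof -
  obtain a where "\<forall>y\<in>D. u y = (\<Sum>j=1..N. a j * K (x j) y)"
    using assms by (auto simp: kernel_span_def)
  then have "\<forall>y\<in>D. c * u y = (\<Sum>j=1..N. (c * a j) * K (x j) y)"
    by (simp add: sum_distrib_left mult.assoc)
  then show ?thesis
    unfolding kernel_span_mem_iff by (rule exI[where x = "\<lambda>j. c * a j"])
qed

lemma kernel_span_diff:
  assumes "u \<in> kernel_span D K x N" "v \<in> kernel_span D K x N"
  shows "(\<lambda>y. u y - v y) \<in> kernel_span D K x N"
  using kernel_span_add[OF assms(1) kernel_span_scale[OF assms(2), of "-1"]] by simp

lemma kernel_span_zero: "(\<lambda>y. 0) \<in> kernel_span D K x N"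
  unfolding kernel_span_mem_iff by (rule exI[where x = "\<lambda>_. 0"]) simp

lemma kernel_span_sum:
  assumes "\<And>i. i \<in> I \<Longrightarrow> g i \<in> kernel_span D K x N"
  shows "(\<lambda>y. \<Sum>i\<in>I. c i * g i y) \<in> kernel_span D K x N"
  using assms
proof (induction I rule: infinite_finite_induct)
  case (insert i I)
  then show ?case
    using kernel_span_add[OF kernel_span_scale[of "g i" _ _ _ _ "c i"] insert.IH] by simp
qed (simp_all add: kernel_span_zero)

lemma kernel_span_cong:
  assumes "u \<in> kernel_span D K x N" "\<And>y. y \<in> D \<Longrightarrow> v y = u y"
  shows "v \<in> kernel_span D K x N"
  using assms by (simp add: kernel_span_def)

lemma kernel_span_Suc_cases:
  assumes "v \<in> kernel_span D K x (Suc N)"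
  obtains v' c where "v' \<in> kernel_span D K x N" "\<And>y. y \<in> D \<Longrightarrow> v y = v' y + c * K (x (Suc N)) y"
proof -
  obtain a where a: "\<forall>y\<in>D. v y = (\<Sum>j=1..Suc N. a j * K (x j) y)"
    using assms by (auto simp: kernel_span_def)
  have "(\<lambda>y. \<Sum>j=1..N. a j * K (x j) y) \<in> kernel_span D K x N"
    by (auto simp: kernel_span_def)
  then show ?thesis using a by (intro that) auto
qed

lemma kernel_span_SucI:
  assumes "v' \<in> kernel_span D K x N" "\<And>y. y \<in> D \<Longrightarrow> v y = v' y + c * K (x (Suc N)) y"
  shows "v \<in> kernel_span D K x (Suc N)"
proof -
  obtain a where "\<forall>y\<in>D. v' y = (\<Sum>j=1..N. a j * K (x j) y)"
    using assms by (auto simp: kernel_span_def)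
  then have "\<forall>y\<in>D. v y = (\<Sum>j=1..Suc N. (a(Suc N := c)) j * K (x j) y)"
    using assms(2) by simp
  then show ?thesis unfolding kernel_span_mem_iff by blast
qed

text \<open>
  Gram--Schmidt, one section at a time.  The invariant is the expansion formula, which by
  itself implies that \<open>s = \<Sum> \<langle>h, g i\<rangle> g i\<close> is the orthogonal projection of the next section \<open>h\<close>.
  The sections may be linearly dependent; then the remainder \<open>h - s\<close> vanishes on \<open>D\<close> and nothing is appended.

  The expansion makes the random Galerkin solution an explicit linear combination of fixed
  functions with random coefficients, hence measurable in \<open>\<omega>\<close>, and it provides the solution of
  the deterministic problem.
\<close>

lemma (in semi_inner_functions) kernel_span_frame:
  assumes definite: "\<And>w. w \<in> H \<Longrightarrow> B w w = 0 \<longleftrightarrow> (\<forall>y\<in>D. w y = 0)"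
    and H_cong: "\<And>u v. u \<in> H \<Longrightarrow> (\<And>y. y \<in> D \<Longrightarrow> v y = u y) \<Longrightarrow> v \<in> H"
    and "\<And>j. j \<in> {1..N} \<Longrightarrow> K (x j) \<in> H"
  shows "\<exists>(n::nat) g. (\<forall>i<n. g i \<in> kernel_span D K x N) \<and>
    (\<forall>v\<in>kernel_span D K x N. \<forall>y\<in>D. v y = (\<Sum>i<n. B v (g i) * g i y))"
  using assms(3)
proof (induction N)
  case 0
  show ?case
    by (rule exI[where x = 0]) (auto simp: kernel_span_def)
next
  case (Suc N)
  let ?V = "kernel_span D K x"
  let ?h = "K (x (Suc N))"
  have Bcong: "B u w = B v w"
    if "u \<in> H" "v \<in> H" "w \<in> H" "\<And>y. y \<in> D \<Longrightarrow> u y = v y" for u v w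
    using that definite by (intro cong[where D = D]) auto
  have VH: "?V (Suc N) \<subseteq> H"
  proof
    fix v assume "v \<in> ?V (Suc N)"
    then obtain a where "\<forall>y\<in>D. v y = (\<Sum>j=1..Suc N. a j * K (x j) y)"
      by (auto simp: kernel_span_def)
    then have eq: "v y = (\<Sum>j=1..Suc N. a j * K (x j) y)" if "y \<in> D" for y
      using that by blast
    have "(\<lambda>y. \<Sum>j=1..Suc N. a j * K (x j) y) \<in> H"
      by (rule sum_mem) (rule Suc.prems)
    then show "v \<in> H" by (rule H_cong) (rule eq)
  qed
  have mono: "v \<in> ?V (Suc N)" if "v \<in> ?V N" for v
    using that by (rule kernel_span_SucI[where c = 0]) simp
  have h: "?h \<in> H" using Suc.prems by simp
  obtain n :: nat and g where gV: "\<And>i. i < n \<Longrightarrow> g i \<in> ?V N"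
    and frame: "\<And>v y. v \<in> ?V N \<Longrightarrow> y \<in> D \<Longrightarrow> v y = (\<Sum>i<n. B v (g i) * g i y)"
  proof -
    have "K (x j) \<in> H" if "j \<in> {1..N}" for j using that by (intro Suc.prems) auto
    from Suc.IH[OF this] show ?thesis using that by blast
  qed
  have gH: "g i \<in> H" if "i < n" for i using gV[OF that] mono VH by auto
  define s where "s = (\<lambda>y. \<Sum>i<n. B ?h (g i) * g i y)"
  have sV: "s \<in> ?V N" unfolding s_def by (intro kernel_span_sum gV) auto
  have sH: "s \<in> H" using sV mono VH by auto
  define r where "r = (\<lambda>y. ?h y - s y)"
  have rH: "r \<in> H" unfolding r_def by (intro diff_mem h sH)
  have orth: "B r v = 0" if v: "v \<in> ?V N" for v
  proof -
    have vH: "v \<in> H" using v mono VH by auto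
    have "B ?h v = B v ?h" by (rule sym[OF h vH])
    also have "\<dots> = B (\<lambda>y. \<Sum>i<n. B v (g i) * g i y) ?h"
      by (rule Bcong) (auto intro!: vH sum_mem gH h frame v)
    also have "\<dots> = (\<Sum>i<n. B v (g i) * B (g i) ?h)"
      by (rule sum_left) (auto intro: gH h)
    also have "\<dots> = (\<Sum>i<n. B ?h (g i) * B (g i) v)"
      by (intro sum.cong refl) (simp add: sym[OF vH gH] sym[OF h gH])
    also have "\<dots> = B s v"
      unfolding s_def by (rule sum_left[symmetric]) (auto intro: gH vH)
    finally show ?thesis unfolding r_def using h sH vH by (simp add: diff_left)
  qed
  have split: "\<exists>v'\<in>?V N. \<exists>c. \<forall>y\<in>D. v y = v' y + c * r y" if "v \<in> ?V (Suc N)" for v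
    using that
  proof (cases rule: kernel_span_Suc_cases)
    case (1 v' c)
    show ?thesis
    proof (intro bexI exI ballI)
      show "(\<lambda>y. v' y + c * s y) \<in> ?V N"
        by (intro kernel_span_add kernel_span_scale 1 sV)
      show "v y = v' y + c * s y + c * r y" if "y \<in> D" for y
        using 1(2)[OF that] by (simp add: r_def algebra_simps)
    qed
  qed
  show ?case
  proof (cases "B r r = 0")
    case True
    then have r0: "r y = 0" if "y \<in> D" for y using definite[OF rH] that by auto
    have "v \<in> ?V N" if v: "v \<in> ?V (Suc N)" for v
    proof -
      obtain v' c where "v' \<in> ?V N" "\<forall>y\<in>D. v y = v' y + c * r y"
        using split[OF v] by auto
      then show ?thesis by (intro kernel_span_cong[where v = v and u = v']) (auto simp: r0)
    qed
    then show ?thesis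
      by (intro exI[where x = n] exI[where x = g] conjI allI impI ballI frame mono gV)
  next
    case False
    define q where "q = sqrt (B r r)"
    have q: "q * q = B r r" "q > 0" using nonneg[OF rH] False by (auto simp: q_def)
    define g' where "g' = g(n := (\<lambda>y. (1 / q) * r y))"
    have rV: "r \<in> ?V (Suc N)"
      by (rule kernel_span_SucI[where c = 1, OF kernel_span_scale[OF sV, of "-1"]])
        (simp add: r_def)
    show ?thesis
    proof (intro exI[where x = "Suc n"] exI[where x = g'] conjI allI impI ballI)
      fix i assume "i < Suc n"
      then show "g' i \<in> ?V (Suc N)"
        by (cases "i = n") (auto simp: g'_def intro!: mono gV kernel_span_scale[OF rV, of "1/q", simplified])
    next
      fix v y assume v: "v \<in> ?V (Suc N)" and y: "y \<in> D"
      obtain v' c where v': "v' \<in> ?V N" and dec: "\<And>y. y \<in> D \<Longrightarrow> v y = v' y + c * r y"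
        using split[OF v] by auto
      have v'H: "v' \<in> H" using v' mono VH by auto
      have vw: "B v w = B v' w + c * B r w" if "w \<in> H" for w
      proof -
        have "B v w = B (\<lambda>y. v' y + c * r y) w"
          using v VH by (intro Bcong that add_mem scale_mem v'H rH dec) auto
        then show ?thesis using that v'H rH by (simp add: add_left scale_mem scale_left)
      qed
      have "B v' r = 0" using orth[OF v'] sym[OF v'H rH] by simp
      then have "B v (g' n) = c * q"
        using q rH v'H
        by (simp add: g'_def vw scale_mem[where c = "1/q", simplified]
            scale_right[where c = "1/q", simplified] flip: q(1))
      moreover have "B v (g' i) = B v' (g i)" if "i < n" for i
        using that by (simp add: g'_def vw gH orth gV)
      moreover have "g' i = g i" if "i < n" for i using that by (simp add: g'_def)
      ultimately have "(\<Sum>i<Suc n. B v (g' i) * g' i y)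
          = (\<Sum>i<n. B v' (g i) * g i y) + c * q * g' n y" by simp
      also have "\<dots> = v' y + c * r y" using frame[OF v' y] q by (simp add: g'_def)
      finally show "v y = (\<Sum>i<Suc n. B v (g' i) * g' i y)" using dec[OF y] by simp
    qed
  qed
qed

section \<open>Mercer expansions in the Hilbert space and in \<open>L\<^sup>2\<close>\<close>

lemma (in rkhs) semi_inner_functions: "semi_inner_functions H ip"
  by (rule semi_inner_functions.intro)
    (auto intro: H_zero H_add H_scale ip_sym ip_add ip_scale ip_nonneg)

lemma integrable_mult_of_squares:
  fixes u v :: "'a \<Rightarrow> real"
  assumes [measurable]: "u \<in> borel_measurable \<mu>" "v \<in> borel_measurable \<mu>"
    and "integrable \<mu> (\<lambda>x. (u x)\<^sup>2)" "integrable \<mu> (\<lambda>x. (v x)\<^sup>2)"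
  shows "integrable \<mu> (\<lambda>x. u x * v x)"
proof (rule Bochner_Integration.integrable_bound)
  show "integrable \<mu> (\<lambda>x. (u x)\<^sup>2 + (v x)\<^sup>2)" using assms by simp
  have "\<bar>a * b\<bar> \<le> a\<^sup>2 + b\<^sup>2" for a b :: real
    using sum_squares_bound[of a b] sum_squares_bound[of "- a" b] by (auto simp: abs_le_iff)
  then show "AE x in \<mu>. norm (u x * v x) \<le> norm ((u x)\<^sup>2 + (v x)\<^sup>2)" by simp
qed simp

context mercer_rkhs
begin

sublocale RK: semi_inner_functions H ip
  by (rule semi_inner_functions)

abbreviation "D \<equiv> space \<mu>"

definition onb_fun :: "nat \<Rightarrow> 'a \<Rightarrow> real" where
  "onb_fun l = (\<lambda>x. sqrt (\<beta> l) * \<phi> l x)"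

definition diag_integral :: real where
  "diag_integral = (LINT x|\<mu>. K x x)"

lemma onb_fun_mem: "onb_fun l \<in> H"
  unfolding onb_fun_def by (rule onb_in_H)

lemma onb_fun_orthonormal: "ip (onb_fun k) (onb_fun l) = (if k = l then 1 else 0)"
  unfolding onb_fun_def by (rule onb_orthonormal)

lemma ip_cong:
  assumes "u \<in> H" "v \<in> H" "w \<in> H" "\<And>y. y \<in> D \<Longrightarrow> u y = v y"
  shows "ip u w = ip v w"
  using assms ip_eq_0 by (intro RK.cong[where D = D]) auto

text \<open>
  Point evaluation is bounded with square norm \<open>K x x\<close>, and \<open>K x x\<close> is integrable.  Convergence in
  the Hilbert space therefore implies convergence pointwise and in \<open>L\<^sup>2\<close>, so that all three limits
  of a Fourier series are the same function.
\<close>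

lemma pointwise_bound:
  assumes "u \<in> H" "x \<in> D"
  shows "(u x)\<^sup>2 \<le> ip u u * K x x"
  using RK.cauchy_schwarz[OF assms(1) section_in_H[OF assms(2)]] assms
  by (simp add: reproducing section_in_H)

text \<open>Fourier partial sums converge in the Hilbert space: they are Cauchy by Bessel, and their limit
  differs from \<open>u\<close> by an element orthogonal to a complete system.\<close>

lemma fourier_partial_sum_tendsto:
  assumes u: "u \<in> H"
  defines "S \<equiv> \<lambda>n x. \<Sum>l<n. ip u (onb_fun l) * onb_fun l x"
  shows "(\<lambda>n. ip (\<lambda>x. u x - S n x) (\<lambda>x. u x - S n x)) \<longlonglongrightarrow> 0"
proof -
  let ?a = "\<lambda>l. ip u (onb_fun l)"
  have S: "S n \<in> H" for n unfolding S_def by (intro RK.sum_mem onb_fun_mem)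
  have bessel: "ip (\<lambda>x. u x - S n x) (\<lambda>x. u x - S n x) = ip u u - (\<Sum>l<n. (?a l)\<^sup>2)" for n
    unfolding S_def by (rule RK.bessel_identity) (auto intro: onb_fun_mem u simp: onb_fun_orthonormal)
  have "(\<Sum>l<n. (?a l)\<^sup>2) \<le> ip u u" for n
    using bessel[of n] ip_nonneg[OF RK.diff_mem[OF u S[of n]]] by simp
  then have sm: "summable (\<lambda>l. (?a l)\<^sup>2)"
    by (intro summableI_nonneg_bounded[where x = "ip u u"]) auto
  have diff: "ip (\<lambda>x. S m x - S n x) (\<lambda>x. S m x - S n x) = (\<Sum>l\<in>{min m n..<max m n}. (?a l)\<^sup>2)"
    for m n
  proof -
    define c where "c = (\<lambda>l. (if m \<le> n then -1 else 1) * ?a l)"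
    have "S m x - S n x = (\<Sum>l\<in>{min m n..<max m n}. c l * onb_fun l x)" for x
    proof (cases "m \<le> n")
      case True
      then show ?thesis
        unfolding S_def c_def
        using sum_diff_nat_ivl[of 0 m n "\<lambda>l. ?a l * onb_fun l x"]
        by (simp add: lessThan_atLeast0 sum_negf)
    next
      case False
      then show ?thesis
        unfolding S_def c_def
        using sum_diff_nat_ivl[of 0 n m "\<lambda>l. ?a l * onb_fun l x"]
        by (simp add: lessThan_atLeast0 sum_negf)
    qed
    then have "ip (\<lambda>x. S m x - S n x) (\<lambda>x. S m x - S n x)
        = (\<Sum>l\<in>{min m n..<max m n}. (c l)\<^sup>2)"
      by (simp, intro RK.norm_orthonormal_sum) (auto intro: onb_fun_mem simp: onb_fun_orthonormal)
    then show ?thesis by (simp add: c_def power_mult_distrib)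
  qed
  have "\<exists>w\<in>H. (\<lambda>n. sqrt (ip (\<lambda>x. S n x - w x) (\<lambda>x. S n x - w x))) \<longlonglongrightarrow> 0"
  proof (rule complete[OF S])
    fix r :: real assume r: "0 < r"
    then have "0 < r\<^sup>2" by simp
    then obtain n0 where n0: "\<And>m n. m \<ge> n0 \<Longrightarrow> norm (sum (\<lambda>l. (?a l)\<^sup>2) {m..<n}) < r\<^sup>2"
      using sm unfolding summable_Cauchy by blast
    show "\<exists>n0. \<forall>m\<ge>n0. \<forall>n\<ge>n0. sqrt (ip (\<lambda>x. S m x - S n x) (\<lambda>x. S m x - S n x)) < r"
    proof (intro exI[where x = n0] allI impI)
      fix m n assume "n0 \<le> m" "n0 \<le> n"
      then have "ip (\<lambda>x. S m x - S n x) (\<lambda>x. S m x - S n x) < r\<^sup>2"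
        using n0[of "min m n" "max m n"] unfolding diff by auto
      then show "sqrt (ip (\<lambda>x. S m x - S n x) (\<lambda>x. S m x - S n x)) < r"
        using r by (intro real_less_lsqrt) auto
    qed
  qed
  then obtain w where w: "w \<in> H"
    and lim: "(\<lambda>n. sqrt (ip (\<lambda>x. S n x - w x) (\<lambda>x. S n x - w x))) \<longlonglongrightarrow> 0" by blast
  have lim2: "(\<lambda>n. ip (\<lambda>x. S n x - w x) (\<lambda>x. S n x - w x)) \<longlonglongrightarrow> 0"
    using tendsto_power[OF lim, of 2] ip_nonneg[OF RK.diff_mem[OF S w]] by simp
  have uw: "\<forall>x\<in>D. u x - w x = 0"
  proof (rule onb_complete[OF RK.diff_mem[OF u w]], fold onb_fun_def)
    fix l
    have le: "(ip (\<lambda>x. u x - w x) (onb_fun l))\<^sup>2 \<le> ip (\<lambda>x. S n x - w x) (\<lambda>x. S n x - w x)" if "n > l" for n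
    proof -
      have "ip (S n) (onb_fun l) = (\<Sum>k<n. ip u (onb_fun k) * (if k = l then 1 else 0))"
        unfolding S_def by (simp add: RK.sum_left onb_fun_mem onb_fun_orthonormal)
      also have "\<dots> = (\<Sum>k<n. if k = l then ip u (onb_fun k) else 0)"
        by (intro sum.cong) auto
      also have "\<dots> = ip u (onb_fun l)" using that by simp
      finally have "ip (\<lambda>x. u x - w x) (onb_fun l) = ip (\<lambda>x. S n x - w x) (onb_fun l)"
        using u w S onb_fun_mem by (simp add: RK.diff_left)
      then show ?thesis
        using RK.cauchy_schwarz[OF RK.diff_mem[OF S w] onb_fun_mem, of n l] by (simp add: onb_fun_orthonormal)
    qed
    have "(ip (\<lambda>x. u x - w x) (onb_fun l))\<^sup>2 \<le> 0"
      by (rule tendsto_lowerbound[OF lim2]) (auto intro!: eventually_sequentiallyI[of "Suc l"] le)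
    then show "ip (\<lambda>x. u x - w x) (onb_fun l) = 0" by simp
  qed
  have "ip (\<lambda>x. u x - S n x) (\<lambda>x. u x - S n x) = ip (\<lambda>x. S n x - w x) (\<lambda>x. S n x - w x)" for n
  proof -
    let ?p = "\<lambda>x. u x - S n x" and ?q = "\<lambda>x. -1 * (S n x - w x)"
    have H: "?p \<in> H" "?q \<in> H" by (intro RK.diff_mem RK.scale_mem u w S)+
    have eq: "?p y = ?q y" if "y \<in> D" for y using uw that by auto
    have "ip ?p ?p = ip ?q ?p" by (rule ip_cong[OF H H(1) eq])
    also have "\<dots> = ip ?p ?q" by (rule ip_sym[OF H(2,1)])
    also have "\<dots> = ip ?q ?q" by (rule ip_cong[OF H H(2) eq])
    also have "\<dots> = ip (\<lambda>x. S n x - w x) (\<lambda>x. S n x - w x)"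
      using RK.diff_mem[OF S[of n] w]
      by (subst RK.scale_left, assumption, intro RK.scale_mem, assumption, subst RK.scale_right)
        auto
    finally show ?thesis .
  qed
  then show ?thesis using lim2 by simp
qed

lemma phi_measurable [measurable]: "\<phi> l \<in> borel_measurable \<mu>"
  using phi_in_l2 by (simp add: l2_space_def)

lemma phi_mem: "\<phi> l \<in> H"
  using RK.scale_mem[OF onb_fun_mem, of "1 / sqrt (\<beta> l)" l] beta_pos[of l] by (simp add: onb_fun_def)

lemma H_measurable:
  assumes u: "u \<in> H"
  shows "u \<in> borel_measurable \<mu>"
proof -
  define S where "S n x = (\<Sum>l<n. ip u (onb_fun l) * onb_fun l x)" for n x
  have S: "S n \<in> H" for n unfolding S_def by (intro RK.sum_mem onb_fun_mem)
  show ?thesis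
  proof (rule borel_measurable_LIMSEQ_real)
    show "S n \<in> borel_measurable \<mu>" for n unfolding S_def onb_fun_def by measurable
    fix x assume x: "x \<in> D"
    have "(\<lambda>n. ip (\<lambda>x. u x - S n x) (\<lambda>x. u x - S n x) * K x x) \<longlonglongrightarrow> 0"
      using tendsto_mult_left_zero[OF fourier_partial_sum_tendsto[OF u]] by (simp add: S_def)
    then have "(\<lambda>n. (u x - S n x)\<^sup>2) \<longlonglongrightarrow> 0"
      by (rule Lim_null_comparison[rotated])
        (use pointwise_bound[OF RK.diff_mem[OF u S] x] in simp)
    then have "(\<lambda>n. u x - S n x) \<longlonglongrightarrow> 0"
      by (metis power_tendsto_0_iff zero_less_numeral)
    then show "(\<lambda>n. S n x) \<longlonglongrightarrow> u x" by (simp add: LIMSEQ_iff abs_minus_commute)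
  qed
qed

lemma H_square_integrable:
  assumes u: "u \<in> H"
  shows "integrable \<mu> (\<lambda>x. (u x)\<^sup>2)"
proof (rule Bochner_Integration.integrable_bound)
  show "integrable \<mu> (\<lambda>x. ip u u * K x x)" using integrable_diag by simp
  show "(\<lambda>x. (u x)\<^sup>2) \<in> borel_measurable \<mu>" using H_measurable[OF u] by measurable
  show "AE x in \<mu>. norm ((u x)\<^sup>2) \<le> norm (ip u u * K x x)"
    using pointwise_bound[OF u] by (auto intro!: AE_I2 intro: order_trans[OF _ abs_ge_self])
qed

lemma H_mult_integrable:
  assumes "u \<in> H" "v \<in> H"
  shows "integrable \<mu> (\<lambda>x. u x * v x)"
  by (intro integrable_mult_of_squares H_measurable H_square_integrable assms)

sublocale L2: semi_inner_functions H "l2_inner \<mu>"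
  by (rule semi_inner_functions.intro)
    (simp_all add: H_zero H_add H_scale l2_inner_def ring_distribs mult.assoc H_mult_integrable
      mult.commute mult.left_commute)

lemma l2_le_ip:
  assumes u: "u \<in> H"
  shows "l2_inner \<mu> u u \<le> ip u u * diag_integral"
proof -
  have "l2_inner \<mu> u u \<le> (LINT x|\<mu>. ip u u * K x x)"
    unfolding l2_inner_def
    using H_square_integrable[OF u] integrable_diag pointwise_bound[OF u]
    by (intro integral_mono) (auto simp: power2_eq_square)
  then show ?thesis by (simp add: diag_integral_def)
qed

lemma l2_cong:
  assumes "\<And>y. y \<in> D \<Longrightarrow> u y = v y"
  shows "l2_inner \<mu> u w = l2_inner \<mu> v w"
  unfolding l2_inner_def using assms by (intro Bochner_Integration.integral_cong) auto

abbreviation coef :: "('a \<Rightarrow> real) \<Rightarrow> nat \<Rightarrow> real" where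
  "coef u l \<equiv> l2_inner \<mu> u (\<phi> l)"

definition trunc :: "('a \<Rightarrow> real) \<Rightarrow> nat \<Rightarrow> 'a \<Rightarrow> real" where
  "trunc u n = (\<lambda>x. \<Sum>l<n. coef u l * \<phi> l x)"

lemma trunc_mem: "trunc u n \<in> H"
  unfolding trunc_def by (intro RK.sum_mem phi_mem)

text \<open>
  The \<open>\<phi> l\<close> are orthogonal for both inner products, so the identity is clear for partial sums;
  it survives the limit because the remainders tend to zero in \<open>L\<^sup>2\<close>.
\<close>

lemma coef_eq:
  assumes u: "u \<in> H"
  shows "coef u l = sqrt (\<beta> l) * ip u (onb_fun l)"
proof -
  define S where "S n x = (\<Sum>l<n. ip u (onb_fun l) * onb_fun l x)" for n x
  have S: "S n \<in> H" for n unfolding S_def by (intro RK.sum_mem onb_fun_mem)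
  have ephi: "l2_inner \<mu> (onb_fun k) (\<phi> l) = (if k = l then sqrt (\<beta> k) else 0)" for k
    unfolding onb_fun_def by (simp add: L2.scale_left phi_mem phi_orthonormal)
  have le: "(coef u l - sqrt (\<beta> l) * ip u (onb_fun l))\<^sup>2
      \<le> ip (\<lambda>x. u x - S n x) (\<lambda>x. u x - S n x) * diag_integral" if "n > l" for n
  proof -
    have "coef (S n) l = (\<Sum>k<n. ip u (onb_fun k) * (if k = l then sqrt (\<beta> k) else 0))"
      unfolding S_def by (simp add: L2.sum_left onb_fun_mem phi_mem ephi)
    also have "\<dots> = (\<Sum>k<n. if k = l then ip u (onb_fun k) * sqrt (\<beta> k) else 0)"
      by (intro sum.cong) auto
    also have "\<dots> = sqrt (\<beta> l) * ip u (onb_fun l)" using that by simp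
    finally have "coef u l - sqrt (\<beta> l) * ip u (onb_fun l) = coef (\<lambda>x. u x - S n x) l"
      using u S phi_mem by (simp add: L2.diff_left)
    also have "(coef (\<lambda>x. u x - S n x) l)\<^sup>2
        \<le> l2_inner \<mu> (\<lambda>x. u x - S n x) (\<lambda>x. u x - S n x)"
      using L2.cauchy_schwarz[OF RK.diff_mem[OF u S] phi_mem, of n l] by (simp add: phi_orthonormal)
    also have "\<dots> \<le> ip (\<lambda>x. u x - S n x) (\<lambda>x. u x - S n x) * diag_integral"
      by (rule l2_le_ip[OF RK.diff_mem[OF u S]])
    finally show ?thesis .
  qed
  have "(\<lambda>n. ip (\<lambda>x. u x - S n x) (\<lambda>x. u x - S n x) * diag_integral) \<longlonglongrightarrow> 0"
    using tendsto_mult_left_zero[OF fourier_partial_sum_tendsto[OF u]] by (simp add: S_def)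
  then have "(coef u l - sqrt (\<beta> l) * ip u (onb_fun l))\<^sup>2 \<le> 0"
    by (rule tendsto_lowerbound) (auto intro!: eventually_sequentiallyI[of "Suc l"] le)
  then show ?thesis by simp
qed

lemma trunc_eq:
  assumes "u \<in> H"
  shows "trunc u n = (\<lambda>x. \<Sum>l<n. ip u (onb_fun l) * onb_fun l x)"
  unfolding trunc_def using assms by (simp add: coef_eq onb_fun_def mult_ac)

lemma trunc_tendsto:
  assumes "u \<in> H"
  shows "(\<lambda>n. ip (\<lambda>x. u x - trunc u n x) (\<lambda>x. u x - trunc u n x)) \<longlonglongrightarrow> 0"
  using fourier_partial_sum_tendsto[OF assms] by (simp add: trunc_eq[OF assms])

lemma trunc_tendsto_l2:
  assumes u: "u \<in> H"
  shows "(\<lambda>n. l2_inner \<mu> (\<lambda>x. u x - trunc u n x) (\<lambda>x. u x - trunc u n x)) \<longlonglongrightarrow> 0"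
proof (rule Lim_null_comparison)
  show "\<forall>\<^sub>F n in sequentially.
     norm (l2_inner \<mu> (\<lambda>x. u x - trunc u n x) (\<lambda>x. u x - trunc u n x))
     \<le> ip (\<lambda>x. u x - trunc u n x) (\<lambda>x. u x - trunc u n x) * diag_integral"
    using l2_le_ip[OF RK.diff_mem[OF u trunc_mem]] L2.nonneg[OF RK.diff_mem[OF u trunc_mem]]
    by simp
  show "(\<lambda>n. ip (\<lambda>x. u x - trunc u n x) (\<lambda>x. u x - trunc u n x) * diag_integral) \<longlonglongrightarrow> 0"
    by (rule tendsto_mult_left_zero[OF trunc_tendsto[OF u]])
qed

lemma trunc_tendsto_pointwise:
  assumes u: "u \<in> H" and x: "x \<in> D"
  shows "(\<lambda>n. trunc u n x) \<longlonglongrightarrow> u x"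
proof -
  have "(\<lambda>n. (u x - trunc u n x)\<^sup>2) \<longlonglongrightarrow> 0"
  proof (rule Lim_null_comparison)
    show "\<forall>\<^sub>F n in sequentially. norm ((u x - trunc u n x)\<^sup>2)
       \<le> ip (\<lambda>x. u x - trunc u n x) (\<lambda>x. u x - trunc u n x) * K x x"
      using pointwise_bound[OF RK.diff_mem[OF u trunc_mem] x] by simp
    show "(\<lambda>n. ip (\<lambda>x. u x - trunc u n x) (\<lambda>x. u x - trunc u n x) * K x x) \<longlonglongrightarrow> 0"
      by (rule tendsto_mult_left_zero[OF trunc_tendsto[OF u]])
  qed
  then have "(\<lambda>n. u x - trunc u n x) \<longlonglongrightarrow> 0"
    by (metis power_tendsto_0_iff zero_less_numeral)
  then show ?thesis by (simp add: LIMSEQ_iff abs_minus_commute)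
qed

lemma tendsto_inner_trunc:
  assumes "semi_inner_functions H B" and u: "u \<in> H" and v: "v \<in> H"
    and lim: "(\<lambda>n. B (\<lambda>x. u x - trunc u n x) (\<lambda>x. u x - trunc u n x)) \<longlonglongrightarrow> 0"
  shows "(\<lambda>n. B (trunc u n) v) \<longlonglongrightarrow> B u v"
proof -
  interpret B: semi_inner_functions H B by fact
  have "(\<lambda>n. (B u v - B (trunc u n) v)\<^sup>2) \<longlonglongrightarrow> 0"
  proof (rule Lim_null_comparison)
    show "\<forall>\<^sub>F n in sequentially. norm ((B u v - B (trunc u n) v)\<^sup>2)
       \<le> B (\<lambda>x. u x - trunc u n x) (\<lambda>x. u x - trunc u n x) * B v v"
      using B.cauchy_schwarz[OF B.diff_mem[OF u trunc_mem] v] u v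
      by (simp add: B.diff_left trunc_mem)
    show "(\<lambda>n. B (\<lambda>x. u x - trunc u n x) (\<lambda>x. u x - trunc u n x) * B v v) \<longlonglongrightarrow> 0"
      by (rule tendsto_mult_left_zero[OF lim])
  qed
  then have "(\<lambda>n. B u v - B (trunc u n) v) \<longlonglongrightarrow> 0"
    by (metis power_tendsto_0_iff zero_less_numeral)
  then show ?thesis by (simp add: LIMSEQ_iff abs_minus_commute)
qed

lemma l2_expansion:
  assumes u: "u \<in> H" and v: "v \<in> H"
  shows "(\<lambda>l. coef u l * coef v l) sums l2_inner \<mu> u v"
proof -
  have "l2_inner \<mu> (trunc u n) v = (\<Sum>l<n. coef u l * coef v l)" for n
    unfolding trunc_def using v by (simp add: L2.sum_left phi_mem L2.sym[OF v phi_mem])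
  with tendsto_inner_trunc[OF L2.semi_inner_functions_axioms u v trunc_tendsto_l2[OF u]]
  show ?thesis by (simp add: sums_def)
qed

lemma ip_phi:
  assumes "v \<in> H"
  shows "ip (\<phi> l) v = coef v l / \<beta> l"
proof -
  have "ip (onb_fun l) v = ip v (onb_fun l)" by (rule RK.sym[OF onb_fun_mem assms])
  moreover have "ip (onb_fun l) v = sqrt (\<beta> l) * ip (\<phi> l) v"
    unfolding onb_fun_def by (rule RK.scale_left[OF phi_mem assms])
  ultimately have "coef v l = (sqrt (\<beta> l) * sqrt (\<beta> l)) * ip (\<phi> l) v"
    by (metis coef_eq[OF assms] mult.assoc)
  then show ?thesis using beta_pos[of l] by simp
qed

lemma ip_expansion:
  assumes u: "u \<in> H" and v: "v \<in> H"
  shows "(\<lambda>l. coef u l * coef v l / \<beta> l) sums ip u v"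
proof -
  have "ip (trunc u n) v = (\<Sum>l<n. coef u l * coef v l / \<beta> l)" for n
    unfolding trunc_def using v by (simp add: RK.sum_left phi_mem ip_phi)
  with tendsto_inner_trunc[OF RK.semi_inner_functions_axioms u v trunc_tendsto[OF u]]
  show ?thesis by (simp add: sums_def)
qed

text \<open>
  Distributing \<open>\<beta>\<^sup>-\<^sup>1\<close> in \<open>\<langle>f,v\<rangle>\<^sub>K = \<Sum> \<beta>\<^sup>-\<^sup>1 f\<^sub>l v\<^sub>l\<close> entirely to \<open>f\<close> and applying Cauchy--Schwarz.  This
  trades the Hilbert norm of \<open>v\<close> for its \<open>L\<^sup>2\<close> norm, at the price of a stronger norm of \<open>f\<close>; it is
  what raises the squared bias from order \<open>\<lambda>\<close> to order \<open>\<lambda>\<^sup>2\<close>.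
\<close>

lemma ip_le_power_norm:
  assumes f: "f \<in> H" "f \<in> power_space \<mu> \<beta> \<phi> 2" and v: "v \<in> H"
  shows "(ip f v)\<^sup>2 \<le> (power_norm \<mu> \<beta> \<phi> 2 f)\<^sup>2 * l2_inner \<mu> v v"
proof -
  let ?c = "\<lambda>l. \<beta> l powr (-2) * (coef f l)\<^sup>2"
  have sm: "summable ?c" using f(2) by (simp add: power_space_def)
  have norm: "(power_norm \<mu> \<beta> \<phi> 2 f)\<^sup>2 = (\<Sum>l. ?c l)"
    unfolding power_norm_def using sm by (simp add: suminf_nonneg)
  have beta: "\<beta> l powr (-2) = (1 / \<beta> l)\<^sup>2" for l
    using beta_pos[of l] by (simp add: powr_minus powr_realpow divide_simps)
  have le: "(\<Sum>l<n. coef f l * coef v l / \<beta> l)\<^sup>2 \<le> (power_norm \<mu> \<beta> \<phi> 2 f)\<^sup>2 * l2_inner \<mu> v v" for n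
  proof -
    have "(\<Sum>l<n. coef f l * coef v l / \<beta> l)\<^sup>2 = (\<Sum>l<n. (1 / \<beta> l * coef f l) * coef v l)\<^sup>2"
      by (simp add: mult.commute mult.left_commute divide_inverse)
    also have "\<dots> \<le> (\<Sum>l<n. (1 / \<beta> l * coef f l)\<^sup>2) * (\<Sum>l<n. (coef v l)\<^sup>2)"
      by (rule Cauchy_Schwarz_ineq_sum)
    also have "\<dots> = (\<Sum>l<n. ?c l) * (\<Sum>l<n. coef v l * coef v l)"
      by (simp add: beta power_mult_distrib power2_eq_square)
    also have "\<dots> \<le> (\<Sum>l. ?c l) * l2_inner \<mu> v v"
      unfolding sums_unique[OF l2_expansion[OF v v]]
      using sm l2_expansion[OF v v]
      by (intro mult_mono sum_le_suminf sum_nonneg suminf_nonneg) (auto simp: sums_iff)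
    finally show ?thesis unfolding norm .
  qed
  show ?thesis
    using tendsto_power[OF ip_expansion[OF f(1) v, unfolded sums_def], of 2]
    by (rule tendsto_upperbound) (simp_all only: le eventually_True sequentially_bot not_False_eq_True)
qed

end

section \<open>The bias of the regularised Galerkin solution\<close>

context mercer_rkhs
begin

lemma lambda_semi_inner_functions:
  assumes "0 < lam"
  shows "semi_inner_functions H (lambda_inner \<mu> ip lam)"
  using assms
  by (intro semi_inner_functions.intro)
    (auto simp: lambda_inner_def H_zero H_add H_scale L2.add_left RK.add_left L2.scale_left
      RK.scale_left L2.nonneg RK.nonneg L2.sym RK.sym ring_distribs)

lemma lambda_inner_eq_0_iff:
  assumes "0 < lam" and u: "u \<in> H"
  shows "lambda_inner \<mu> ip lam u u = 0 \<longleftrightarrow> (\<forall>x\<in>D. u x = 0)"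
proof
  assume "lambda_inner \<mu> ip lam u u = 0"
  then have "ip u u = 0"
    using assms L2.nonneg[OF u] RK.nonneg[OF u]
    by (simp add: lambda_inner_def add_nonneg_eq_0_iff)
  then show "\<forall>x\<in>D. u x = 0" using ip_eq_0[OF u] by simp
next
  assume z: "\<forall>x\<in>D. u x = 0"
  then have "l2_inner \<mu> u u = l2_inner \<mu> (\<lambda>_. 0) u" by (intro l2_cong) auto
  then show "lambda_inner \<mu> ip lam u u = 0"
    using z ip_eq_0[OF u] by (simp add: lambda_inner_def l2_inner_def)
qed

text \<open>
  Pythagoras for the functional \<open>w \<mapsto> \<parallel>w - f\<parallel>\<^sup>2 + \<lambda> \<parallel>w\<parallel>\<^sub>K\<^sup>2\<close>: the Galerkin equation says that its
  derivative at \<open>u\<close> in the direction \<open>u - g\<close> is zero, so moving from \<open>u\<close> to \<open>g\<close> costs exactly the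
  quadratic term.
\<close>

lemma bias_identity:
  assumes u: "u \<in> H" and g: "g \<in> H" and f: "f \<in> H"
    and galerkin: "lambda_inner \<mu> ip lam u (\<lambda>x. u x - g x) = l2_inner \<mu> f (\<lambda>x. u x - g x)"
  defines "err \<equiv> \<lambda>w. l2_inner \<mu> (\<lambda>x. w x - f x) (\<lambda>x. w x - f x)"
  shows "err g + lam * ip g g
    = err u + lam * ip u u + lambda_inner \<mu> ip lam (\<lambda>x. u x - g x) (\<lambda>x. u x - g x)"
proof -
  have l2: "l2_inner \<mu> g u = l2_inner \<mu> u g" "l2_inner \<mu> f u = l2_inner \<mu> u f"
    "l2_inner \<mu> f g = l2_inner \<mu> g f" "ip g u = ip u g"
    using assms by (auto intro: L2.sym RK.sym)
  show ?thesis
    using galerkin assms(1-3)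
    by (simp add: err_def lambda_inner_def L2.diff_left L2.diff_right RK.diff_left RK.diff_right
        RK.diff_mem l2 algebra_simps)
qed

text \<open>The identity compares \<open>u\<close> with \<open>g\<close>; orthogonality of \<open>f - g\<close> and \<open>g\<close> gives \<open>\<parallel>g\<parallel>\<^sub>K \<le> \<parallel>f\<parallel>\<^sub>K\<close>.\<close>

lemma bias_bound:
  assumes lam: "0 < lam" and u: "u \<in> H" and g: "g \<in> H" and f: "f \<in> H"
    and galerkin: "lambda_inner \<mu> ip lam u (\<lambda>x. u x - g x) = l2_inner \<mu> f (\<lambda>x. u x - g x)"
    and proj: "ip (\<lambda>x. f x - g x) g = 0"
  shows "l2_inner \<mu> (\<lambda>x. u x - f x) (\<lambda>x. u x - f x)
    \<le> l2_inner \<mu> (\<lambda>x. g x - f x) (\<lambda>x. g x - f x) + lam * ip f f"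
proof -
  interpret L: semi_inner_functions H "lambda_inner \<mu> ip lam"
    by (rule lambda_semi_inner_functions[OF lam])
  have "ip f g = ip g g" using proj f g by (simp add: RK.diff_left)
  then have "ip f f - ip g g = ip (\<lambda>x. f x - g x) (\<lambda>x. f x - g x)"
    using f g RK.sym[OF f g] by (simp add: RK.diff_left RK.diff_right RK.diff_mem)
  then have "ip g g \<le> ip f f"
    using RK.nonneg[OF RK.diff_mem[OF f g]] by simp
  then have "lam * ip g g \<le> lam * ip f f" using lam by simp
  moreover have "0 \<le> lam * ip u u" using lam RK.nonneg[OF u] by simp
  ultimately show ?thesis
    using bias_identity[OF u g f galerkin] L.nonneg[OF L.diff_mem[OF u g]] by linarith
qed

text \<open>
  Write \<open>U = \<parallel>u - f\<parallel>\<close>, \<open>a = \<parallel>g - f\<parallel>\<close> and \<open>c = \<lambda> \<parallel>f\<parallel>\<close> with the norm of order 2 of \<open>f\<close>.  Testing the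
  Galerkin equation with \<open>d = u - g\<close> and replacing \<open>\<langle>g,d\<rangle>\<^sub>K\<close> by \<open>\<langle>f,d\<rangle>\<^sub>K\<close>, as \<open>f - g\<close> is orthogonal to \<open>d\<close>,
  gives \<open>\<langle>u - f, d\<rangle> \<le> c \<parallel>d\<parallel> \<le> c (U + a)\<close>.  Since \<open>u - f = d + (g - f)\<close>, this yields
  \<open>U\<^sup>2 \<le> c (U + a) + U a\<close>, and absorbing \<open>U\<close> leaves \<open>3 a\<^sup>2 + 3 c\<^sup>2\<close>.  Estimating \<open>\<parallel>d\<parallel>\<close> first and
  applying the triangle inequality to \<open>u - f\<close> would put the factor 4 in front of \<open>a\<^sup>2\<close>.
\<close>

lemma bias_bound_smooth:
  assumes lam: "0 < lam" and u: "u \<in> H" and g: "g \<in> H" and f: "f \<in> H"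
    and galerkin: "lambda_inner \<mu> ip lam u (\<lambda>x. u x - g x) = l2_inner \<mu> f (\<lambda>x. u x - g x)"
    and proj: "ip (\<lambda>x. f x - g x) (\<lambda>x. u x - g x) = 0"
    and smooth: "f \<in> power_space \<mu> \<beta> \<phi> 2"
  shows "l2_inner \<mu> (\<lambda>x. u x - f x) (\<lambda>x. u x - f x)
    \<le> 3 * l2_inner \<mu> (\<lambda>x. g x - f x) (\<lambda>x. g x - f x) + 3 * lam\<^sup>2 * (power_norm \<mu> \<beta> \<phi> 2 f)\<^sup>2"
proof -
  define d where "d = (\<lambda>x. u x - g x)"
  define w where "w = (\<lambda>x. u x - f x)"
  define r where "r = (\<lambda>x. g x - f x)"
  have mem: "d \<in> H" "w \<in> H" "r \<in> H"
    unfolding d_def w_def r_def by (intro RK.diff_mem u g f)+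
  define U where "U = sqrt (l2_inner \<mu> w w)"
  define a where "a = sqrt (l2_inner \<mu> r r)"
  define E where "E = sqrt (l2_inner \<mu> d d)"
  define c where "c = lam * power_norm \<mu> \<beta> \<phi> 2 f"
  have c0: "0 \<le> c"
    unfolding c_def power_norm_def using lam smooth
    by (intro mult_nonneg_nonneg) (auto simp: power_space_def intro!: suminf_nonneg)
  have sq: "U\<^sup>2 = l2_inner \<mu> w w" "a\<^sup>2 = l2_inner \<mu> r r" "E\<^sup>2 = l2_inner \<mu> d d"
    "0 \<le> U" "0 \<le> a" "0 \<le> E"
    using mem by (simp_all add: U_def a_def E_def L2.nonneg)
  have w_dr: "w = (\<lambda>x. d x + r x)" and d_wr: "d = (\<lambda>x. w x - r x)"
    by (auto simp: d_def w_def r_def)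
  have cs: "\<bar>l2_inner \<mu> p q\<bar> \<le> sqrt (l2_inner \<mu> p p) * sqrt (l2_inner \<mu> q q)"
    if "p \<in> H" "q \<in> H" for p q
    using real_sqrt_le_mono[OF L2.cauchy_schwarz[OF that]] by (simp add: real_sqrt_mult)
  have E_le: "E \<le> U + a"
  proof (rule power2_le_imp_le)
    have "E\<^sup>2 = l2_inner \<mu> w w - 2 * l2_inner \<mu> w r + l2_inner \<mu> r r"
      unfolding sq(3) d_wr using mem L2.sym[OF mem(2,3)]
      by (simp add: L2.diff_left L2.diff_right L2.diff_mem)
    also have "\<dots> \<le> (U + a)\<^sup>2"
      using cs[OF mem(2,3)] by (simp add: power2_sum sq flip: U_def a_def)
    finally show "E\<^sup>2 \<le> (U + a)\<^sup>2" .
  qed (use sq in simp)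
  have "l2_inner \<mu> w d = - lam * ip u d"
    using galerkin u f mem
    unfolding d_def[symmetric] w_def by (simp add: lambda_inner_def L2.diff_left)
  also have "ip u d = ip d d + ip g d"
    using u g mem unfolding d_def by (simp add: RK.diff_left)
  also have "ip g d = ip f d"
    using proj f g mem unfolding d_def[symmetric] by (simp add: RK.diff_left)
  finally have wd: "l2_inner \<mu> w d = - lam * ip d d - lam * ip f d" by (simp add: algebra_simps)
  have "(ip f d)\<^sup>2 \<le> (power_norm \<mu> \<beta> \<phi> 2 f * E)\<^sup>2"
    using ip_le_power_norm[OF f smooth mem(1)] by (simp add: power_mult_distrib sq)
  then have "\<bar>ip f d\<bar> \<le> \<bar>power_norm \<mu> \<beta> \<phi> 2 f * E\<bar>"
    by (simp only: abs_le_square_iff)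
  also have "\<dots> = power_norm \<mu> \<beta> \<phi> 2 f * E"
    using sq(6) c0 lam by (simp add: c_def zero_le_mult_iff)
  finally have "lam * \<bar>ip f d\<bar> \<le> c * E" using lam by (simp add: c_def)
  moreover have "- (lam * ip f d) \<le> lam * \<bar>ip f d\<bar>"
    using mult_left_mono[of "- ip f d" "\<bar>ip f d\<bar>" lam] lam by simp
  moreover have "0 \<le> lam * ip d d" using lam RK.nonneg[OF mem(1)] by simp
  ultimately have wd_le: "l2_inner \<mu> w d \<le> c * E" using wd by simp
  have "U\<^sup>2 = l2_inner \<mu> w d + l2_inner \<mu> w r"
    unfolding sq(1) using mem by (subst (2) w_dr) (simp add: L2.add_right)
  also have "\<dots> \<le> c * (U + a) + U * a"
    using wd_le mult_left_mono[OF E_le c0] cs[OF mem(2,3)]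
    unfolding U_def[symmetric] a_def[symmetric] by linarith
  finally have main: "U\<^sup>2 \<le> c * (U + a) + U * a" .
  have "U * (c + a) \<le> U\<^sup>2 / 2 + (c + a)\<^sup>2 / 2"
    using sum_squares_bound[of U "c + a"] by simp
  then have "U\<^sup>2 \<le> (c + a)\<^sup>2 + 2 * c * a"
    using main by (simp add: algebra_simps)
  also have "\<dots> \<le> 3 * a\<^sup>2 + 3 * c\<^sup>2"
    using sum_squares_bound[of c a] by (simp add: power2_sum algebra_simps)
  finally show ?thesis
    using sq(1,2) unfolding w_def r_def c_def by (simp add: power_mult_distrib)
qed

section \<open>The sampling error in a dual norm\<close>

text \<open>Coefficientwise this is \<open>t\<^sup>\<tau> \<le> 1 + t\<close> at \<open>t = \<lambda> / \<beta> l\<close>, which holds for exponents in \<open>[0, 1]\<close>.\<close>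

lemma interpolation:
  assumes lam: "0 < lam" and tau: "0 < \<tau>" "\<tau> \<le> 1" and d: "d \<in> H"
  shows "lam powr \<tau> * (\<Sum>l<n. \<beta> l powr (-\<tau>) * (coef d l)\<^sup>2) \<le> lambda_inner \<mu> ip lam d d"
proof -
  have young: "lam powr \<tau> * \<beta> l powr (-\<tau>) \<le> 1 + lam / \<beta> l" for l
  proof -
    let ?t = "lam / \<beta> l"
    have t: "0 < ?t" using lam beta_pos[of l] by simp
    have "lam powr \<tau> * \<beta> l powr (-\<tau>) = ?t powr \<tau>"
      using lam beta_pos[of l] by (simp add: powr_minus powr_divide) (simp add: divide_inverse)
    also have "\<dots> \<le> 1 + ?t"
    proof (cases "?t \<le> 1")
      case True
      then have "?t powr \<tau> \<le> 1" using t tau by (intro powr_le1) auto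
      then show ?thesis using t by simp
    next
      case False
      then have "?t powr \<tau> \<le> ?t powr 1" using tau by (intro powr_mono) auto
      then show ?thesis using t by simp
    qed
    finally show ?thesis .
  qed
  have "(\<lambda>l. coef d l * coef d l + lam * (coef d l * coef d l / \<beta> l)) sums lambda_inner \<mu> ip lam d d"
    unfolding lambda_inner_def
    by (intro sums_add sums_mult l2_expansion ip_expansion d)
  then have s: "(\<lambda>l. (1 + lam / \<beta> l) * (coef d l)\<^sup>2) sums lambda_inner \<mu> ip lam d d"
    by (simp add: ring_distribs power2_eq_square)
  have "lam powr \<tau> * (\<Sum>l<n. \<beta> l powr (-\<tau>) * (coef d l)\<^sup>2)
      = (\<Sum>l<n. (lam powr \<tau> * \<beta> l powr (-\<tau>)) * (coef d l)\<^sup>2)"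
    by (simp add: sum_distrib_left mult.assoc)
  also have "\<dots> \<le> (\<Sum>l<n. (1 + lam / \<beta> l) * (coef d l)\<^sup>2)"
    by (intro sum_mono mult_right_mono young) auto
  also have "\<dots> \<le> lambda_inner \<mu> ip lam d d"
    unfolding sums_unique[OF s] using s beta_pos lam
    by (intro sum_le_suminf) (auto simp: sums_iff intro!: mult_nonneg_nonneg add_nonneg_nonneg divide_nonneg_pos)
  finally show ?thesis .
qed

text \<open>
  With \<open>Z = \<Sum> \<beta>\<^sup>\<tau> \<Lambda>(\<phi> l)\<^sup>2\<close>, weighted Cauchy--Schwarz on the expansion of \<open>d\<close> and interpolation give
  \<open>\<lambda>\<^sup>\<tau> \<Lambda>(d)\<^sup>2 \<le> Z \<langle>d,d\<rangle>\<^sub>\<lambda>\<close>.  As \<open>\<Lambda>(d) = \<langle>d,d\<rangle>\<^sub>\<lambda>\<close>, one factor cancels.  The statement is in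
  \<open>[0, \<infinity>]\<close> so that it can be integrated over \<open>\<omega>\<close> without knowing beforehand where \<open>Z\<close> is finite.
\<close>

lemma variational_dual_bound:
  fixes \<Lambda> :: "('a \<Rightarrow> real) \<Rightarrow> real"
  assumes lam: "0 < lam" and tau: "0 < \<tau>" "\<tau> \<le> 1" and d: "d \<in> H"
    and trunc: "\<And>n. \<Lambda> (trunc d n) = (\<Sum>l<n. coef d l * \<Lambda> (\<phi> l))"
    and lim: "(\<lambda>n. \<Lambda> (trunc d n)) \<longlonglongrightarrow> \<Lambda> d"
    and eq: "lambda_inner \<mu> ip lam d d = \<Lambda> d"
  shows "ennreal (l2_inner \<mu> d d)
    \<le> ennreal (lam powr (-\<tau>)) * (\<Sum>l. ennreal (\<beta> l powr \<tau> * (\<Lambda> (\<phi> l))\<^sup>2))"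
proof (cases "(\<Sum>l. ennreal (\<beta> l powr \<tau> * (\<Lambda> (\<phi> l))\<^sup>2)) = top")
  case True
  then show ?thesis using lam by (simp add: ennreal_mult_top)
next
  case False
  let ?z = "\<lambda>l. \<beta> l powr \<tau> * (\<Lambda> (\<phi> l))\<^sup>2"
  let ?L = "lambda_inner \<mu> ip lam d d"
  have z: "summable ?z" using False by (intro summable_suminf_not_top) auto
  have l2: "l2_inner \<mu> d d \<le> ?L" using lam RK.nonneg[OF d] by (simp add: lambda_inner_def)
  have L0: "0 \<le> ?L" using l2 L2.nonneg[OF d] by simp
  have le: "lam powr \<tau> * (\<Lambda> (trunc d n))\<^sup>2 \<le> suminf ?z * ?L" for n
  proof -
    have half: "(\<beta> l powr (\<tau> / 2))\<^sup>2 = \<beta> l powr \<tau>" "(\<beta> l powr (- (\<tau> / 2)))\<^sup>2 = \<beta> l powr (-\<tau>)" for l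
      using beta_pos[of l] by (simp_all add: power2_eq_square flip: powr_add)
    have "\<Lambda> (trunc d n) = (\<Sum>l<n. (\<beta> l powr (\<tau> / 2) * \<Lambda> (\<phi> l)) * (\<beta> l powr (- (\<tau> / 2)) * coef d l))"
      unfolding trunc
    proof (intro sum.cong refl)
      fix l show "coef d l * \<Lambda> (\<phi> l)
          = (\<beta> l powr (\<tau> / 2) * \<Lambda> (\<phi> l)) * (\<beta> l powr (- (\<tau> / 2)) * coef d l)"
        using beta_pos[of l] by (simp add: powr_minus field_simps)
    qed
    then have "(\<Lambda> (trunc d n))\<^sup>2
        \<le> (\<Sum>l<n. (\<beta> l powr (\<tau> / 2) * \<Lambda> (\<phi> l))\<^sup>2) * (\<Sum>l<n. (\<beta> l powr (- (\<tau> / 2)) * coef d l)\<^sup>2)"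
      using Cauchy_Schwarz_ineq_sum by metis
    also have "\<dots> = (\<Sum>l<n. ?z l) * (\<Sum>l<n. \<beta> l powr (-\<tau>) * (coef d l)\<^sup>2)"
      by (simp add: power_mult_distrib half)
    finally have "lam powr \<tau> * (\<Lambda> (trunc d n))\<^sup>2
        \<le> lam powr \<tau> * ((\<Sum>l<n. ?z l) * (\<Sum>l<n. \<beta> l powr (-\<tau>) * (coef d l)\<^sup>2))"
      by (intro mult_left_mono) auto
    also have "\<dots> = (\<Sum>l<n. ?z l) * (lam powr \<tau> * (\<Sum>l<n. \<beta> l powr (-\<tau>) * (coef d l)\<^sup>2))"
      by simp
    also have "\<dots> \<le> suminf ?z * ?L"
      using z by (intro mult_mono interpolation lam tau d sum_le_suminf suminf_nonneg)
        (auto intro!: sum_nonneg mult_nonneg_nonneg)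
    finally show ?thesis .
  qed
  have "(\<lambda>n. lam powr \<tau> * (\<Lambda> (trunc d n))\<^sup>2) \<longlonglongrightarrow> lam powr \<tau> * (\<Lambda> d)\<^sup>2"
    by (intro tendsto_intros lim)
  then have "lam powr \<tau> * (\<Lambda> d)\<^sup>2 \<le> suminf ?z * ?L"
    by (rule tendsto_upperbound) (simp_all only: le eventually_True sequentially_bot not_False_eq_True)
  then have "(lam powr \<tau> * ?L) * ?L \<le> suminf ?z * ?L"
    by (simp add: eq power2_eq_square mult.assoc)
  then have "lam powr \<tau> * ?L \<le> suminf ?z"
  proof (cases "?L = 0")
    case True
    then show ?thesis using z by (simp add: suminf_nonneg)
  qed (use L0 in auto)
  then have "?L \<le> lam powr (-\<tau>) * suminf ?z"
    using lam by (simp add: powr_minus field_simps)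
  then have "l2_inner \<mu> d d \<le> lam powr (-\<tau>) * suminf ?z" using l2 by simp
  then have "ennreal (l2_inner \<mu> d d) \<le> ennreal (lam powr (-\<tau>) * suminf ?z)"
    by (rule ennreal_leI)
  also have "\<dots> = ennreal (lam powr (-\<tau>)) * (\<Sum>l. ennreal (?z l))"
  proof -
    have "(\<Sum>l. ennreal (?z l)) = ennreal (suminf ?z)"
      using z by (intro suminf_ennreal_eq) auto
    moreover have "ennreal (lam powr (-\<tau>) * suminf ?z) = ennreal (lam powr (-\<tau>)) * ennreal (suminf ?z)"
      using z by (intro ennreal_mult suminf_nonneg) auto
    ultimately show ?thesis by simp
  qed
  finally show ?thesis .
qed

end

section \<open>The variance of the sample mean\<close>

lemma K_tau_diag:
  "K_tau \<beta> \<phi> \<tau> y y = enn2ereal (\<Sum>l. ennreal (\<beta> l powr \<tau> * (\<phi> l y)\<^sup>2))"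
proof -
  have "K_tau \<beta> \<phi> \<tau> y y = (\<Sum>l. enn2ereal (ennreal (\<beta> l powr \<tau> * (\<phi> l y)\<^sup>2)))"
    unfolding K_tau_def by (intro suminf_cong) (simp add: power2_eq_square mult.assoc enn2ereal_ennreal)
  then show ?thesis by (simp only: suminf_enn2ereal)
qed

text \<open>All terms are nonnegative, so integral and series may be exchanged.  The right-hand side is the
  form in which the pairing bounds the sum of the variances.\<close>

lemma K_tau_pairing_eq:
  assumes [measurable]: "\<And>l. \<phi> l \<in> borel_measurable \<mu>" "f \<in> borel_measurable \<mu>"
    and f: "AE y in \<mu>. 0 \<le> f y"
  shows "K_tau_pairing \<mu> \<beta> \<phi> \<tau> f
    = (\<Sum>l. ennreal (\<beta> l powr \<tau>) * (\<integral>\<^sup>+y. ennreal (f y) * ennreal ((\<phi> l y)\<^sup>2) \<partial>\<mu>))"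
proof -
  have "K_tau_pairing \<mu> \<beta> \<phi> \<tau> f
      = (\<integral>\<^sup>+y. (\<Sum>l. ennreal (\<beta> l powr \<tau>) * (ennreal (f y) * ennreal ((\<phi> l y)\<^sup>2))) \<partial>\<mu>)"
    unfolding K_tau_pairing_def
  proof (intro nn_integral_cong_AE, use f in eventually_elim)
    fix y assume "0 \<le> f y"
    let ?k = "\<Sum>l. ennreal (\<beta> l powr \<tau> * (\<phi> l y)\<^sup>2)"
    have "K_tau \<beta> \<phi> \<tau> y y * ereal (f y) = enn2ereal (?k * ennreal (f y))"
      using \<open>0 \<le> f y\<close> by (simp only: K_tau_diag times_ennreal.rep_eq enn2ereal_ennreal)
    then have "e2ennreal (K_tau \<beta> \<phi> \<tau> y y * ereal (f y)) = ?k * ennreal (f y)"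
      by (simp only: e2ennreal_enn2ereal)
    also have "\<dots> = (\<Sum>l. ennreal (\<beta> l powr \<tau> * (\<phi> l y)\<^sup>2) * ennreal (f y))"
      by (simp only: ennreal_suminf_multc)
    also have "\<dots> = (\<Sum>l. ennreal (\<beta> l powr \<tau>) * (ennreal (f y) * ennreal ((\<phi> l y)\<^sup>2)))"
      by (simp only: ennreal_mult powr_ge_zero zero_le_power2 mult_ac)
    finally show "e2ennreal (K_tau \<beta> \<phi> \<tau> y y * ereal (f y))
      = (\<Sum>l. ennreal (\<beta> l powr \<tau>) * (ennreal (f y) * ennreal ((\<phi> l y)\<^sup>2)))" .
  qed
  then show ?thesis by (simp add: nn_integral_suminf nn_integral_cmult)
qed

lemma (in prob_space) expectation_sum_square:
  fixes Z :: "'i \<Rightarrow> 'a \<Rightarrow> real"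
  assumes I: "finite I" and indep: "indep_vars (\<lambda>_. borel) Z I"
    and int: "\<And>i. i \<in> I \<Longrightarrow> integrable M (Z i)"
    and int2: "\<And>i. i \<in> I \<Longrightarrow> integrable M (\<lambda>\<omega>. (Z i \<omega>)\<^sup>2)"
    and mean: "\<And>i. i \<in> I \<Longrightarrow> expectation (Z i) = 0"
  shows "integrable M (\<lambda>\<omega>. (\<Sum>i\<in>I. Z i \<omega>)\<^sup>2)"
    and "expectation (\<lambda>\<omega>. (\<Sum>i\<in>I. Z i \<omega>)\<^sup>2) = (\<Sum>i\<in>I. expectation (\<lambda>\<omega>. (Z i \<omega>)\<^sup>2))"
proof -
  have sq: "(\<Sum>i\<in>I. Z i \<omega>)\<^sup>2 = (\<Sum>i\<in>I. \<Sum>j\<in>I. Z i \<omega> * Z j \<omega>)" for \<omega>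
    by (simp add: power2_eq_square sum_product)
  have prod: "integrable M (\<lambda>\<omega>. Z i \<omega> * Z j \<omega>) \<and>
      expectation (\<lambda>\<omega>. Z i \<omega> * Z j \<omega>) = (if i = j then expectation (\<lambda>\<omega>. (Z i \<omega>)\<^sup>2) else 0)"
    if ij: "i \<in> I" "j \<in> I" for i j
  proof (cases "i = j")
    case True
    then show ?thesis using int2[of i] ij by (simp add: power2_eq_square)
  next
    case False
    have ind: "indep_vars (\<lambda>_. borel) Z {i, j}"
      by (rule indep_vars_subset[OF indep]) (use ij in auto)
    show ?thesis
      using indep_vars_lebesgue_integral[OF _ ind int] indep_vars_integrable[OF _ ind int] ij False
      by (auto simp: mean)
  qed
  show "integrable M (\<lambda>\<omega>. (\<Sum>i\<in>I. Z i \<omega>)\<^sup>2)"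
    unfolding sq by (intro Bochner_Integration.integrable_sum conjunct1[OF prod])
  have "expectation (\<lambda>\<omega>. (\<Sum>i\<in>I. Z i \<omega>)\<^sup>2)
      = (\<Sum>i\<in>I. expectation (\<lambda>\<omega>. \<Sum>j\<in>I. Z i \<omega> * Z j \<omega>))"
    unfolding sq by (intro Bochner_Integration.integral_sum Bochner_Integration.integrable_sum
        conjunct1[OF prod])
  also have "\<dots> = (\<Sum>i\<in>I. \<Sum>j\<in>I. expectation (\<lambda>\<omega>. Z i \<omega> * Z j \<omega>))"
    by (intro sum.cong refl Bochner_Integration.integral_sum conjunct1[OF prod])
  also have "\<dots> = (\<Sum>i\<in>I. \<Sum>j\<in>I. if i = j then expectation (\<lambda>\<omega>. (Z i \<omega>)\<^sup>2) else 0)"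
    by (intro sum.cong refl conjunct2[OF prod])
  finally show "expectation (\<lambda>\<omega>. (\<Sum>i\<in>I. Z i \<omega>)\<^sup>2) = (\<Sum>i\<in>I. expectation (\<lambda>\<omega>. (Z i \<omega>)\<^sup>2))"
    using I by simp
qed

locale density_sample = mercer_rkhs \<mu> K H ip \<beta> \<phi> + P: prob_space P
  for \<mu> :: "'a measure" and K H ip \<beta> \<phi> and P :: "'w measure" +
  fixes Y :: "nat \<Rightarrow> 'w \<Rightarrow> 'a" and M :: nat and f :: "'a \<Rightarrow> real"
  assumes f_mem: "f \<in> H"
    and f_nonneg: "AE y in \<mu>. 0 \<le> f y"
    and sample_size: "1 \<le> M"
    and indep: "P.indep_vars (\<lambda>_. \<mu>) Y {1..M}"
    and density: "\<And>m. m \<in> {1..M} \<Longrightarrow> distributed P \<mu> (Y m) (\<lambda>y. ennreal (f y))"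
begin

lemma Y_measurable: "m \<in> {1..M} \<Longrightarrow> Y m \<in> measurable P \<mu>"
  using density by (simp add: distributed_def)

lemma Y_in_space: "m \<in> {1..M} \<Longrightarrow> \<omega> \<in> space P \<Longrightarrow> Y m \<omega> \<in> D"
  using measurable_space[OF Y_measurable] .

lemma sample_law:
  assumes m: "m \<in> {1..M}" and [measurable]: "h \<in> borel_measurable \<mu>"
  shows "integrable P (\<lambda>\<omega>. h (Y m \<omega>)) \<longleftrightarrow> integrable \<mu> (\<lambda>y. f y * h y)"
    and "(LINT \<omega>|P. h (Y m \<omega>)) = l2_inner \<mu> f h"
proof -
  \<comment> \<open>The density is nonnegative only almost everywhere; its positive part induces the same law.\<close>
  let ?f = "\<lambda>y. max 0 (f y)"
  note [measurable] = H_measurable[OF f_mem]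
  have ae: "AE y in \<mu>. ?f y * h y = f y * h y"
    using f_nonneg by eventually_elim (simp add: max_def)
  have "(\<lambda>y. ennreal (f y)) = (\<lambda>y. ennreal (?f y))"
    by (intro ext) (simp add: max_def ennreal_neg)
  then have d: "distributed P \<mu> (Y m) (\<lambda>y. ennreal (?f y))"
    using density[OF m] by simp
  have "integrable P (\<lambda>\<omega>. h (Y m \<omega>)) \<longleftrightarrow> integrable \<mu> (\<lambda>y. ?f y * h y)"
    using distributed_integrable[OF d] by simp
  also have "\<dots> \<longleftrightarrow> integrable \<mu> (\<lambda>y. f y * h y)"
    using ae by (intro integrable_cong_AE) simp_all
  finally show "integrable P (\<lambda>\<omega>. h (Y m \<omega>)) \<longleftrightarrow> integrable \<mu> (\<lambda>y. f y * h y)" .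
  have "(LINT \<omega>|P. h (Y m \<omega>)) = (LINT y|\<mu>. ?f y * h y)"
    using distributed_integral[OF d] by simp
  also have "\<dots> = (LINT y|\<mu>. f y * h y)"
    using ae by (intro integral_cong_AE) simp_all
  finally show "(LINT \<omega>|P. h (Y m \<omega>)) = l2_inner \<mu> f h" by (simp add: l2_inner_def)
qed

text \<open>
  The deviation of the sample mean from its expectation, as a functional.  Its value at \<open>v\<close> is
  centred, with variance at most the second moment of \<open>v\<close> under \<open>f\<close> divided by \<open>M\<close>.
\<close>

definition dev :: "'w \<Rightarrow> ('a \<Rightarrow> real) \<Rightarrow> real" where
  "dev \<omega> v = sample_mean M (\<lambda>m. Y m \<omega>) v - l2_inner \<mu> f v"

lemma dev_eq:
  "dev \<omega> v = (1 / real M) * (\<Sum>m=1..M. v (Y m \<omega>) - l2_inner \<mu> f v)"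
  using sample_size by (simp add: dev_def sample_mean_def sum_subtractf right_diff_distrib)

lemma dev_measurable:
  assumes "v \<in> H"
  shows "(\<lambda>\<omega>. dev \<omega> v) \<in> borel_measurable P"
  unfolding dev_eq using H_measurable[OF assms] Y_measurable
  by (intro borel_measurable_times borel_measurable_const borel_measurable_sum
      borel_measurable_diff) (auto intro: measurable_compose)

lemma dev_mean_zero:
  assumes v: "v \<in> H"
  shows "integrable P (\<lambda>\<omega>. dev \<omega> v)" and "(LINT \<omega>|P. dev \<omega> v) = 0"
proof -
  have int: "integrable P (\<lambda>\<omega>. v (Y m \<omega>) - l2_inner \<mu> f v)" if "m \<in> {1..M}" for m
    using sample_law(1)[OF that H_measurable[OF v]] H_mult_integrable[OF f_mem v]
    by simp
  show "integrable P (\<lambda>\<omega>. dev \<omega> v)"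
    unfolding dev_eq by (intro integrable_mult_right Bochner_Integration.integrable_sum int)
  have "(LINT \<omega>|P. v (Y m \<omega>) - l2_inner \<mu> f v) = 0" if "m \<in> {1..M}" for m
    using sample_law[OF that H_measurable[OF v]] H_mult_integrable[OF f_mem v]
    by (simp add: P.prob_space)
  then show "(LINT \<omega>|P. dev \<omega> v) = 0"
    unfolding dev_eq by (simp add: Bochner_Integration.integral_sum int del: sum_subtractf)
qed

lemma dev_variance:
  assumes v: "v \<in> H"
  shows "(\<integral>\<^sup>+\<omega>. ennreal ((dev \<omega> v)\<^sup>2) \<partial>P)
    \<le> ennreal (1 / real M) * (\<integral>\<^sup>+y. ennreal (f y) * ennreal ((v y)\<^sup>2) \<partial>\<mu>)"
proof (cases "(\<integral>\<^sup>+y. ennreal (f y) * ennreal ((v y)\<^sup>2) \<partial>\<mu>) = \<infinity>")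
  case True
  then show ?thesis using sample_size by (simp add: ennreal_mult_top)
next
  case False
  note [measurable] = H_measurable[OF f_mem] H_measurable[OF v]
  have nn: "(\<integral>\<^sup>+y. ennreal (f y) * ennreal ((v y)\<^sup>2) \<partial>\<mu>) = (\<integral>\<^sup>+y. ennreal (f y * (v y)\<^sup>2) \<partial>\<mu>)"
    using f_nonneg by (intro nn_integral_cong_AE) (auto simp: ennreal_mult')
  have ae: "AE y in \<mu>. 0 \<le> f y * (v y)\<^sup>2" using f_nonneg by eventually_elim simp
  have int: "integrable \<mu> (\<lambda>y. f y * (v y)\<^sup>2)"
    using False ae unfolding nn by (intro integrableI_nonneg) (auto simp: top.not_eq_extremum)
  define s where "s = (LINT y|\<mu>. f y * (v y)\<^sup>2)"
  have s: "(\<integral>\<^sup>+y. ennreal (f y) * ennreal ((v y)\<^sup>2) \<partial>\<mu>) = ennreal s"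
    unfolding nn s_def by (rule nn_integral_eq_integral[OF int ae])
  define Z where "Z m \<omega> = v (Y m \<omega>) - l2_inner \<mu> f v" for m \<omega>
  have iv: "integrable P (\<lambda>\<omega>. v (Y m \<omega>))" if "m \<in> {1..M}" for m
    using sample_law(1)[OF that H_measurable[OF v]] H_mult_integrable[OF f_mem v] by simp
  have iv2: "integrable P (\<lambda>\<omega>. (v (Y m \<omega>))\<^sup>2)" "(LINT \<omega>|P. (v (Y m \<omega>))\<^sup>2) = s" if "m \<in> {1..M}" for m
    using sample_law[OF that, of "\<lambda>y. (v y)\<^sup>2"] int
    by (simp_all add: s_def l2_inner_def)
  have ev: "(LINT \<omega>|P. v (Y m \<omega>)) = l2_inner \<mu> f v" if "m \<in> {1..M}" for m
    by (rule sample_law(2)[OF that H_measurable[OF v]])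
  have Z2: "(Z m \<omega>)\<^sup>2 = (v (Y m \<omega>))\<^sup>2 - 2 * l2_inner \<mu> f v * v (Y m \<omega>) + (l2_inner \<mu> f v)\<^sup>2" for m \<omega>
    by (simp add: Z_def power2_diff)
  have Zi: "integrable P (Z m)" if "m \<in> {1..M}" for m
    unfolding Z_def using iv[OF that] by simp
  have Zi2: "integrable P (\<lambda>\<omega>. (Z m \<omega>)\<^sup>2)" if "m \<in> {1..M}" for m
    unfolding Z2 using iv[OF that] iv2[OF that] by simp
  have Z0: "P.expectation (Z m) = 0" if "m \<in> {1..M}" for m
    unfolding Z_def using iv[OF that] ev[OF that] by (simp add: P.prob_space)
  have Zs: "P.expectation (\<lambda>\<omega>. (Z m \<omega>)\<^sup>2) \<le> s" if "m \<in> {1..M}" for m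
    unfolding Z2 using iv[OF that] iv2[OF that] ev[OF that]
    by (simp add: P.prob_space power2_eq_square)
  have Zind: "P.indep_vars (\<lambda>_. borel) Z {1..M}"
    unfolding Z_def by (rule P.indep_vars_compose2[OF indep]) measurable
  note Zsum = P.expectation_sum_square[OF finite_atLeastAtMost Zind Zi Zi2 Z0]
  have dev: "(dev \<omega> v)\<^sup>2 = (1 / real M)\<^sup>2 * (\<Sum>m=1..M. Z m \<omega>)\<^sup>2" for \<omega>
    by (simp add: dev_eq Z_def power_mult_distrib power_divide)
  have "(\<integral>\<^sup>+\<omega>. ennreal ((dev \<omega> v)\<^sup>2) \<partial>P) = ennreal (P.expectation (\<lambda>\<omega>. (dev \<omega> v)\<^sup>2))"
    unfolding dev by (intro nn_integral_eq_integral integrable_mult_right Zsum(1)) auto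
  also have "P.expectation (\<lambda>\<omega>. (dev \<omega> v)\<^sup>2)
      = (1 / real M)\<^sup>2 * (\<Sum>m=1..M. P.expectation (\<lambda>\<omega>. (Z m \<omega>)\<^sup>2))"
    unfolding dev using Zsum(2) by simp
  also have "ennreal \<dots> \<le> ennreal ((1 / real M)\<^sup>2 * (\<Sum>m=1..M. s))"
    by (intro ennreal_leI mult_left_mono sum_mono Zs) auto
  also have "(1 / real M)\<^sup>2 * (\<Sum>m=1..M. s) = 1 / real M * s"
    using sample_size by (simp add: power2_eq_square)
  also have "ennreal (1 / real M * s) = ennreal (1 / real M) * ennreal s"
    by (rule ennreal_mult') simp
  finally show ?thesis unfolding s .
qed

lemma dev_sum:
  assumes "\<And>i. i \<in> I \<Longrightarrow> g i \<in> H"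
  shows "dev \<omega> (\<lambda>y. \<Sum>i\<in>I. c i * g i y) = (\<Sum>i\<in>I. c i * dev \<omega> (g i))"
proof -
  have "sample_mean M (\<lambda>m. Y m \<omega>) (\<lambda>y. \<Sum>i\<in>I. c i * g i y)
      = (\<Sum>i\<in>I. c i * sample_mean M (\<lambda>m. Y m \<omega>) (g i))"
    unfolding sample_mean_def
    by (subst sum.swap) (simp add: sum_distrib_left mult.left_commute)
  then show ?thesis
    unfolding dev_def using assms f_mem
    by (simp add: L2.sum_right right_diff_distrib sum_subtractf)
qed

text \<open>The sample mean needs pointwise convergence of the truncations, the expectation convergence
  in \<open>L\<^sup>2\<close>.\<close>

lemma dev_trunc_tendsto:
  assumes \<omega>: "\<omega> \<in> space P" and v: "v \<in> H"
  shows "(\<lambda>n. dev \<omega> (trunc v n)) \<longlonglongrightarrow> dev \<omega> v"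
proof -
  have "(\<lambda>n. l2_inner \<mu> f (trunc v n)) \<longlonglongrightarrow> l2_inner \<mu> f v"
    using tendsto_inner_trunc[OF L2.semi_inner_functions_axioms v f_mem trunc_tendsto_l2[OF v]]
    by (simp add: L2.sym[OF f_mem] v trunc_mem)
  then show ?thesis
    unfolding dev_def sample_mean_def
    by (intro tendsto_intros trunc_tendsto_pointwise v Y_in_space \<omega>)
qed

text \<open>Integrating the dual bound over \<open>\<omega>\<close> turns every \<open>\<Lambda>(\<phi> l)\<^sup>2\<close> into a variance, and the weighted
  sum of the second moments is the pairing of \<open>K\<^sub>\<tau>\<close> with \<open>f\<close>.\<close>

lemma sampling_error_bound:
  assumes lam: "0 < lam" and tau: "0 < \<tau>" "\<tau> \<le> 1"
    and d: "\<And>\<omega>. \<omega> \<in> space P \<Longrightarrow> d \<omega> \<in> H"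
    and eq: "\<And>\<omega>. \<omega> \<in> space P \<Longrightarrow> lambda_inner \<mu> ip lam (d \<omega>) (d \<omega>) = dev \<omega> (d \<omega>)"
  shows "(\<integral>\<^sup>+\<omega>. ennreal (l2_inner \<mu> (d \<omega>) (d \<omega>)) \<partial>P)
    \<le> ennreal (1 / (real M * lam powr \<tau>)) * K_tau_pairing \<mu> \<beta> \<phi> \<tau> f"
proof -
  note [measurable] = dev_measurable[OF phi_mem]
  let ?I = "\<lambda>l. \<integral>\<^sup>+y. ennreal (f y) * ennreal ((\<phi> l y)\<^sup>2) \<partial>\<mu>"
  have "(\<integral>\<^sup>+\<omega>. ennreal (l2_inner \<mu> (d \<omega>) (d \<omega>)) \<partial>P)
      \<le> (\<integral>\<^sup>+\<omega>. ennreal (lam powr (-\<tau>)) * (\<Sum>l. ennreal (\<beta> l powr \<tau> * (dev \<omega> (\<phi> l))\<^sup>2)) \<partial>P)"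
  proof (intro nn_integral_mono variational_dual_bound[OF lam tau])
    fix \<omega> n assume \<omega>: "\<omega> \<in> space P"
    show "d \<omega> \<in> H" by (rule d[OF \<omega>])
    show "dev \<omega> (trunc (d \<omega>) n) = (\<Sum>l<n. coef (d \<omega>) l * dev \<omega> (\<phi> l))"
      unfolding trunc_def by (rule dev_sum) (rule phi_mem)
    show "(\<lambda>n. dev \<omega> (trunc (d \<omega>) n)) \<longlonglongrightarrow> dev \<omega> (d \<omega>)"
      by (rule dev_trunc_tendsto[OF \<omega> d[OF \<omega>]])
    show "lambda_inner \<mu> ip lam (d \<omega>) (d \<omega>) = dev \<omega> (d \<omega>)" by (rule eq[OF \<omega>])
  qed
  also have "\<dots> = ennreal (lam powr (-\<tau>))
      * (\<Sum>l. ennreal (\<beta> l powr \<tau>) * (\<integral>\<^sup>+\<omega>. ennreal ((dev \<omega> (\<phi> l))\<^sup>2) \<partial>P))"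
    by (simp add: ennreal_mult nn_integral_cmult nn_integral_suminf)
  also have "\<dots> \<le> ennreal (lam powr (-\<tau>))
      * (\<Sum>l. ennreal (\<beta> l powr \<tau>) * (ennreal (1 / real M) * ?I l))"
    by (intro mult_left_mono suminf_le dev_variance phi_mem summableI) auto
  also have "\<dots> = (ennreal (lam powr (-\<tau>)) * ennreal (1 / real M))
      * (\<Sum>l. ennreal (\<beta> l powr \<tau>) * ?I l)"
    by (simp only: mult.left_commute[of "ennreal (\<beta> _ powr \<tau>)"] ennreal_suminf_cmult mult.assoc)
  also have "ennreal (lam powr (-\<tau>)) * ennreal (1 / real M) = ennreal (1 / (real M * lam powr \<tau>))"
    by (subst ennreal_mult[symmetric]) (auto simp: powr_minus divide_simps mult.commute)
  also have "(\<Sum>l. ennreal (\<beta> l powr \<tau>) * ?I l) = K_tau_pairing \<mu> \<beta> \<phi> \<tau> f"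
    using H_measurable[OF f_mem] f_nonneg by (intro K_tau_pairing_eq[symmetric]) auto
  finally show ?thesis .
qed

end

section \<open>The mean integrated squared error\<close>

theorem theorem3p6:
  fixes \<mu> :: "'a measure"
    and K :: "'a \<Rightarrow> 'a \<Rightarrow> real"
    and H :: "('a \<Rightarrow> real) set"
    and ip :: "('a \<Rightarrow> real) \<Rightarrow> ('a \<Rightarrow> real) \<Rightarrow> real"
    and \<beta> :: "nat \<Rightarrow> real"
    and \<phi> :: "nat \<Rightarrow> 'a \<Rightarrow> real"
    and P :: "'w measure"
    and M N :: nat
    and Y :: "nat \<Rightarrow> 'w \<Rightarrow> 'a"
    and x :: "nat \<Rightarrow> 'a"
    and f :: "'a \<Rightarrow> real"
    and lam \<tau> :: real
    and F :: "'w \<Rightarrow> 'a \<Rightarrow> real"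
    and Q :: "('a \<Rightarrow> real) \<Rightarrow> ('a \<Rightarrow> real)"
  defines "V \<equiv> kernel_span (space \<mu>) K x N"
  assumes setting: "mercer_rkhs \<mu> K H ip \<beta> \<phi>"
    and prob: "prob_space P"
    and M: "1 \<le> M"
    and points: "\<And>j. j \<in> {1..N} \<Longrightarrow> x j \<in> space \<mu>"
    and f_in: "f \<in> H"
    and f_nonneg: "AE y in \<mu>. 0 \<le> f y"
    and Y_indep: "prob_space.indep_vars P (\<lambda>_. \<mu>) Y {1..M}"
    and Y_density: "\<And>m. m \<in> {1..M} \<Longrightarrow> distributed P \<mu> (Y m) (\<lambda>y. ennreal (f y))"
    and lam: "0 < lam"
    and F_in: "\<And>\<omega>. \<omega> \<in> space P \<Longrightarrow> F \<omega> \<in> V"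
    and F_eq: "\<And>\<omega> v. \<omega> \<in> space P \<Longrightarrow> v \<in> V \<Longrightarrow>
                 lambda_inner \<mu> ip lam (F \<omega>) v = sample_mean M (\<lambda>m. Y m \<omega>) v"
    and Q: "orthogonal_projection ip H V Q"
    and tau: "0 < \<tau>" "\<tau> \<le> 1"
    and sample_mean_dual: "AE \<omega> in P.
          coeff_functional \<mu> \<phi> (\<lambda>l. sample_mean M (\<lambda>m. Y m \<omega>) (\<phi> l)) \<in> neg_power_space \<mu> \<beta> \<phi> \<tau>"
    and pairing_finite: "K_tau_pairing \<mu> \<beta> \<phi> \<tau> f < \<infinity>"
  shows "(\<forall>\<omega>\<in>space P. integrable \<mu> (\<lambda>y. (F \<omega> y - f y)\<^sup>2)) \<and>
         integrable P (\<lambda>\<omega>. LINT y|\<mu>. (F \<omega> y - f y)\<^sup>2) \<and>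
         (LINT \<omega>|P. (LINT y|\<mu>. (F \<omega> y - f y)\<^sup>2))
           \<le> l2_inner \<mu> (\<lambda>y. Q f y - f y) (\<lambda>y. Q f y - f y) + lam * ip f f
              + enn2real (K_tau_pairing \<mu> \<beta> \<phi> \<tau> f) / (real M * lam powr \<tau>) \<and>
         (f \<in> power_space \<mu> \<beta> \<phi> 2 \<longrightarrow>
          (LINT \<omega>|P. (LINT y|\<mu>. (F \<omega> y - f y)\<^sup>2))
            \<le> 3 * l2_inner \<mu> (\<lambda>y. Q f y - f y) (\<lambda>y. Q f y - f y)
               + 8 * lam\<^sup>2 * (power_norm \<mu> \<beta> \<phi> 2 f)\<^sup>2
               + enn2real (K_tau_pairing \<mu> \<beta> \<phi> \<tau> f) / (real M * lam powr \<tau>))"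
proof -
  interpret mercer_rkhs \<mu> K H ip \<beta> \<phi> by (rule setting)
  interpret P: prob_space P by (rule prob)
  interpret density_sample \<mu> K H ip \<beta> \<phi> P Y M f
    by unfold_locales (use f_in f_nonneg M Y_indep Y_density in auto)
  interpret L: semi_inner_functions H "lambda_inner \<mu> ip lam"
    by (rule lambda_semi_inner_functions[OF lam])
  let ?L = "lambda_inner \<mu> ip lam"
  have VH: "v \<in> H" if "v \<in> V" for v
  proof -
    obtain c where c: "\<forall>y\<in>D. v y = (\<Sum>j=1..N. c j * K (x j) y)"
      using \<open>v \<in> V\<close> unfolding V_def kernel_span_def by blast
    have "(\<lambda>y. \<Sum>j=1..N. c j * K (x j) y) \<in> H"
      by (intro RK.sum_mem section_in_H points)
    then show ?thesis by (rule H_cong) (use c in blast)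
  qed
  have Lcong: "?L p w = ?L q w"
    if "p \<in> H" "q \<in> H" "w \<in> H" "\<And>y. y \<in> D \<Longrightarrow> p y = q y" for p q w
    using that lambda_inner_eq_0_iff[OF lam] by (intro L.cong[where D = D]) auto
  obtain n :: nat and g where gV: "\<And>i. i < n \<Longrightarrow> g i \<in> V"
    and frame: "\<And>v y. v \<in> V \<Longrightarrow> y \<in> D \<Longrightarrow> v y = (\<Sum>i<n. ?L v (g i) * g i y)"
  proof -
    have "\<exists>(n::nat) g. (\<forall>i<n. g i \<in> kernel_span D K x N) \<and>
        (\<forall>v\<in>kernel_span D K x N. \<forall>y\<in>D. v y = (\<Sum>i<n. ?L v (g i) * g i y))"
    proof (rule L.kernel_span_frame)
      show "?L w w = 0 \<longleftrightarrow> (\<forall>y\<in>D. w y = 0)" if "w \<in> H" for w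
        by (rule lambda_inner_eq_0_iff[OF lam that])
      show "v \<in> H" if "p \<in> H" "\<And>y. y \<in> D \<Longrightarrow> v y = p y" for p v
        by (rule H_cong) (use that in auto)
      show "K (x j) \<in> H" if "j \<in> {1..N}" for j by (rule section_in_H[OF points[OF that]])
    qed
    then show ?thesis using that unfolding V_def by blast
  qed
  have gH: "g i \<in> H" if "i < n" for i by (rule VH[OF gV[OF that]])
  \<comment> \<open>The Galerkin solution for the exact functional \<open>v \<mapsto> \<langle>f, v\<rangle>\<close>; it is the mean of \<open>F\<close>.\<close>
  define u where "u = (\<lambda>y. \<Sum>i<n. l2_inner \<mu> f (g i) * g i y)"
  have uV: "u \<in> V" unfolding u_def V_def by (intro kernel_span_sum) (use gV V_def in auto)
  have uH: "u \<in> H" by (rule VH[OF uV])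
  have u_galerkin: "?L u v = l2_inner \<mu> f v" if v: "v \<in> V" for v
  proof -
    have vH: "v \<in> H" by (rule VH[OF v])
    have "?L u v = (\<Sum>i<n. l2_inner \<mu> f (g i) * ?L (g i) v)"
      unfolding u_def by (rule L.sum_left) (auto intro: gH vH)
    also have "\<dots> = (\<Sum>i<n. ?L v (g i) * l2_inner \<mu> f (g i))"
      by (intro sum.cong refl) (simp add: L.sym[OF vH gH])
    also have "\<dots> = l2_inner \<mu> f (\<lambda>y. \<Sum>i<n. ?L v (g i) * g i y)"
      by (rule L2.sum_right[symmetric]) (auto intro: gH f_in)
    also have "\<dots> = l2_inner \<mu> (\<lambda>y. \<Sum>i<n. ?L v (g i) * g i y) f"
      by (rule L2.sym) (auto intro!: f_in L2.sum_mem gH)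
    also have "\<dots> = l2_inner \<mu> v f" by (rule l2_cong) (rule frame[OF v, symmetric])
    also have "\<dots> = l2_inner \<mu> f v" by (rule L2.sym[OF vH f_in])
    finally show ?thesis .
  qed
  \<comment> \<open>The stochastic error solves the same variational problem with the deviation as its data.\<close>
  define d where "d \<omega> = (\<lambda>y. F \<omega> y - u y)" for \<omega>
  have dV: "d \<omega> \<in> V" if "\<omega> \<in> space P" for \<omega>
    using kernel_span_diff[OF F_in[OF that, unfolded V_def] uV[unfolded V_def]]
    unfolding d_def V_def .
  have dH: "d \<omega> \<in> H" if "\<omega> \<in> space P" for \<omega> by (rule VH[OF dV[OF that]])
  have d_eq: "?L (d \<omega>) v = dev \<omega> v" if "\<omega> \<in> space P" "v \<in> V" for \<omega> v
    unfolding d_def dev_def using that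
    by (simp add: L.diff_left VH F_in uH F_eq u_galerkin)
  have d_frame: "d \<omega> y = (\<Sum>i<n. dev \<omega> (g i) * g i y)" if "\<omega> \<in> space P" "y \<in> D" for \<omega> y
    using frame[OF dV[OF that(1)] that(2)] d_eq[OF that(1) gV] by simp

  define err where "err \<omega> = (LINT y|\<mu>. (F \<omega> y - f y)\<^sup>2)" for \<omega>
  define bias where "bias = l2_inner \<mu> (\<lambda>y. u y - f y) (\<lambda>y. u y - f y)"
  define w where "w = (\<lambda>y. u y - f y)"
  have wH: "w \<in> H" unfolding w_def by (rule L2.diff_mem[OF uH f_in])
  have err_eq: "err \<omega> = l2_inner \<mu> (d \<omega>) (d \<omega>) + 2 * l2_inner \<mu> (d \<omega>) w + bias"
    if \<omega>: "\<omega> \<in> space P" for \<omega>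
  proof -
    have "err \<omega> = l2_inner \<mu> (\<lambda>y. d \<omega> y + w y) (\<lambda>y. d \<omega> y + w y)"
      by (simp add: err_def l2_inner_def d_def w_def power2_eq_square)
    also have "\<dots> = l2_inner \<mu> (d \<omega>) (d \<omega>) + 2 * l2_inner \<mu> (d \<omega>) w + l2_inner \<mu> w w"
      using dH[OF \<omega>] wH L2.sym[OF dH[OF \<omega>] wH]
      by (simp add: L2.add_left L2.add_right L2.add_mem)
    finally show ?thesis by (simp add: bias_def w_def)
  qed

  have d_l2: "l2_inner \<mu> (d \<omega>) v = (\<Sum>i<n. dev \<omega> (g i) * l2_inner \<mu> (g i) v)"
    if "\<omega> \<in> space P" "v \<in> H" for \<omega> v
  proof -
    have "l2_inner \<mu> (d \<omega>) v = l2_inner \<mu> (\<lambda>y. \<Sum>i<n. dev \<omega> (g i) * g i y) v"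
      by (rule l2_cong) (rule d_frame[OF that(1)])
    also have "\<dots> = (\<Sum>i<n. dev \<omega> (g i) * l2_inner \<mu> (g i) v)"
      by (rule L2.sum_left) (auto intro: gH that)
    finally show ?thesis .
  qed
  \<comment> \<open>The cross term is linear in the centred deviations, so its mean vanishes.\<close>
  have cross_int: "integrable P (\<lambda>\<omega>. l2_inner \<mu> (d \<omega>) w)"
    and cross_0: "(LINT \<omega>|P. l2_inner \<mu> (d \<omega>) w) = 0"
  proof -
    have int: "integrable P (\<lambda>\<omega>. dev \<omega> (g i) * l2_inner \<mu> (g i) w)" if "i \<in> {..<n}" for i
      using dev_mean_zero(1)[OF gH] that by simp
    have "integrable P (\<lambda>\<omega>. \<Sum>i<n. dev \<omega> (g i) * l2_inner \<mu> (g i) w)"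
      by (intro Bochner_Integration.integrable_sum int)
    then show "integrable P (\<lambda>\<omega>. l2_inner \<mu> (d \<omega>) w)"
      by (rule Bochner_Integration.integrable_cong[THEN iffD2, rotated -1]) (auto simp: d_l2 wH)
    have "(LINT \<omega>|P. l2_inner \<mu> (d \<omega>) w) = (LINT \<omega>|P. (\<Sum>i<n. dev \<omega> (g i) * l2_inner \<mu> (g i) w))"
      by (intro Bochner_Integration.integral_cong) (auto simp: d_l2 wH)
    also have "\<dots> = (\<Sum>i<n. (LINT \<omega>|P. dev \<omega> (g i) * l2_inner \<mu> (g i) w))"
      by (rule Bochner_Integration.integral_sum) (rule int)
    also have "\<dots> = 0" by (intro sum.neutral ballI) (simp add: dev_mean_zero(2) gH)
    finally show "(LINT \<omega>|P. l2_inner \<mu> (d \<omega>) w) = 0" .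
  qed
  have d_meas: "(\<lambda>\<omega>. l2_inner \<mu> (d \<omega>) (d \<omega>)) \<in> borel_measurable P"
  proof -
    have "l2_inner \<mu> (d \<omega>) (d \<omega>)
        = (\<Sum>i<n. dev \<omega> (g i) * (\<Sum>j<n. dev \<omega> (g j) * l2_inner \<mu> (g j) (g i)))"
      if \<omega>: "\<omega> \<in> space P" for \<omega>
    proof -
      have "l2_inner \<mu> (g i) (d \<omega>) = (\<Sum>j<n. dev \<omega> (g j) * l2_inner \<mu> (g j) (g i))" if "i < n" for i
        using L2.sym[OF gH[OF that] dH[OF \<omega>]] d_l2[OF \<omega> gH[OF that]] by simp
      then show ?thesis using d_l2[OF \<omega> dH[OF \<omega>]] by simp
    qed
    then show ?thesis
      using dev_measurable[OF gH]
      by (subst measurable_cong)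
        (auto intro!: borel_measurable_sum borel_measurable_times)
  qed
  define T where "T = enn2real (K_tau_pairing \<mu> \<beta> \<phi> \<tau> f) / (real M * lam powr \<tau>)"
  have T0: "0 \<le> T" by (simp add: T_def)
  have nn: "(\<integral>\<^sup>+\<omega>. ennreal (l2_inner \<mu> (d \<omega>) (d \<omega>)) \<partial>P) \<le> ennreal T"
  proof -
    have "(\<integral>\<^sup>+\<omega>. ennreal (l2_inner \<mu> (d \<omega>) (d \<omega>)) \<partial>P)
        \<le> ennreal (1 / (real M * lam powr \<tau>)) * K_tau_pairing \<mu> \<beta> \<phi> \<tau> f"
      by (rule sampling_error_bound[OF lam tau dH d_eq[OF _ dV]])
    also have "K_tau_pairing \<mu> \<beta> \<phi> \<tau> f = ennreal (enn2real (K_tau_pairing \<mu> \<beta> \<phi> \<tau> f))"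
      using pairing_finite by simp
    also have "ennreal (1 / (real M * lam powr \<tau>)) * \<dots> = ennreal T"
      unfolding T_def by (subst ennreal_mult[symmetric]) auto
    finally show ?thesis .
  qed
  have d_ae: "AE \<omega> in P. 0 \<le> l2_inner \<mu> (d \<omega>) (d \<omega>)"
    by (intro AE_I2 L2.nonneg dH)
  have d_int: "integrable P (\<lambda>\<omega>. l2_inner \<mu> (d \<omega>) (d \<omega>))"
    using d_meas d_ae nn by (intro integrableI_nonneg) (auto intro: le_less_trans)
  have "ennreal (LINT \<omega>|P. l2_inner \<mu> (d \<omega>) (d \<omega>)) \<le> ennreal T"
    using nn nn_integral_eq_integral[OF d_int d_ae] by simp
  then have d_le: "(LINT \<omega>|P. l2_inner \<mu> (d \<omega>) (d \<omega>)) \<le> T" using T0 by simp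

  have err_int: "integrable P err"
  proof -
    have "integrable P (\<lambda>\<omega>. l2_inner \<mu> (d \<omega>) (d \<omega>) + 2 * l2_inner \<mu> (d \<omega>) w + bias)"
      using d_int cross_int by simp
    then show ?thesis
      by (rule Bochner_Integration.integrable_cong[THEN iffD2, rotated -1]) (auto simp: err_eq)
  qed
  have "(LINT \<omega>|P. err \<omega>)
      = (LINT \<omega>|P. l2_inner \<mu> (d \<omega>) (d \<omega>) + 2 * l2_inner \<mu> (d \<omega>) w + bias)"
    by (intro Bochner_Integration.integral_cong) (auto simp: err_eq)
  also have "\<dots> = (LINT \<omega>|P. l2_inner \<mu> (d \<omega>) (d \<omega>)) + bias"
    using d_int cross_int by (simp add: cross_0 P.prob_space)
  finally have mean_err: "(LINT \<omega>|P. err \<omega>) \<le> bias + T" using d_le by simp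

  have QV: "Q f \<in> V" and Q_orth: "\<And>v. v \<in> V \<Longrightarrow> ip (\<lambda>y. f y - Q f y) v = 0"
    using Q f_in by (auto simp: orthogonal_projection_def)
  have QH: "Q f \<in> H" by (rule VH[OF QV])
  have uQ: "(\<lambda>y. u y - Q f y) \<in> V"
    using kernel_span_diff[OF uV[unfolded V_def] QV[unfolded V_def]] unfolding V_def .
  note u_gal = u_galerkin[OF uQ]
  have b1: "bias \<le> l2_inner \<mu> (\<lambda>y. Q f y - f y) (\<lambda>y. Q f y - f y) + lam * ip f f"
    unfolding bias_def by (rule bias_bound[OF lam uH QH f_in u_gal Q_orth[OF QV]])
  have b2: "bias \<le> 3 * l2_inner \<mu> (\<lambda>y. Q f y - f y) (\<lambda>y. Q f y - f y)
      + 8 * lam\<^sup>2 * (power_norm \<mu> \<beta> \<phi> 2 f)\<^sup>2" if "f \<in> power_space \<mu> \<beta> \<phi> 2"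
  proof -
    have "0 \<le> lam\<^sup>2 * (power_norm \<mu> \<beta> \<phi> 2 f)\<^sup>2" by simp
    then show ?thesis
      using bias_bound_smooth[OF lam uH QH f_in u_gal Q_orth[OF uQ] that]
      unfolding bias_def by linarith
  qed
  have "integrable \<mu> (\<lambda>y. (F \<omega> y - f y)\<^sup>2)" if "\<omega> \<in> space P" for \<omega>
    by (rule H_square_integrable[OF RK.diff_mem[OF VH[OF F_in[OF that]] f_in]])
  moreover have "integrable P (\<lambda>\<omega>. LINT y|\<mu>. (F \<omega> y - f y)\<^sup>2)"
    using err_int by (simp add: err_def[abs_def])
  ultimately show ?thesis
    using mean_err b1 b2 unfolding err_def T_def by force
qed

end
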